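(* Let $f,g:\mathbb{Z}_6\to\mathbb{Q}$. Then $\rho_n(f)=\rho_n(g)$ for $n=1,2,3,4,5$ but not for $n=6$ if and only if all of the following hold: (i) $\hat f(e_0)=\hat g(e_0)$; (ii) $\hat f(e_k)=\hat g(e_k)=0$ for $k=2,3,4$; (iii) $|\hat f(e_1)|=|\hat g(e_1)|$; (iv) $\hat f(e_1)^6\neq \hat g(e_1)^6$. Up to scaling, such pairs of functions correspond to natural numbers $L=|\hat f(e_1)|^2$ with more than six distinct factorizations in $\mathbb{Z}[\omega_3]$, or equivalently to $L\in\mathbb{N}$ with at least one prime factor that is $1$ modulo $3$.
   Context: $\mathbb{Z}_6=\mathbb{Z}/6\mathbb{Z}$. For a finite abelian group $G$ and $f:G\to\mathbb{C}$, the $n$th-order autocorrelation of $f$ is the function $\rho_n(f):G^{n-1}\to\mathbb{C}$, $\rho_n(f)(t_1,\dots,t_{n-1})=\sum_{x\in G}f(x)f(x+t_1)\cdots f(x+t_{n-1})$ (for $n=1$ it is the constant $\sum_{x\in G} f(x)$). For $k\in\mathbb{Z}_6$, $e_k$ denotes the character $x\mapsto e^{2\pi i kx/6}$ of $\mathbb{Z}_6$. The Fourier transform is $\hat f(e)=\sum_{x\in G}f(x)\overline{e(x)}$ for a character $e$ of $G$. Here $\omega_3=e^{2\pi i/3}$ is a primitive cube root of unity, so $\mathbb{Z}[\omega_3]$ is the ring of integers of $\mathbb{Q}(e^{2\pi i/6})$. A factorization of $L$ in $\mathbb{Z}[\omega_3]$ means an expression $L=z\bar z$ with $z\in\mathbb{Z}[\omega_3]$,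 that is, a solution of $L=x^2+xy+y^2$ in integers $x,y$, where $z=x+ye^{2\pi i/6}$. "Up to scaling" refers to multiplying $\hat f(e_1)$ and $\hat g(e_1)$ by an integer so that both lie in $\mathbb{Z}[\omega_3]$.
   Formalization: In the last equivalence, L with a prime factor 1 modulo 3 is also required to have at least one factorization L = z z̄ in Z[ω_3]; without this the claim fails, e.g. L = 14 has the prime factor 7 but no factorization. *)

theory Defs
  imports
    Complex_Main
    "HOL-Library.FuncSet"
    "HOL-Library.Numeral_Type"
    "HOL-Number_Theory.Number_Theory"
begin

text \<open>
  The domain \<open>G^(n - 1)\<close> is rendered as the set of extensional functions on the index set
  \<open>{1..<n}\<close>, and the autocorrelation is itself extensional on that domain, so equality of
  autocorrelations is equality of functions \<open>G^(n - 1) \<rightarrow> \<complex>\<close>.  For \<open>n = 1\<close> the domain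
  is a singleton.  Only \<open>n \<ge> 1\<close> is meaningful.
\<close>

definition autocorr ::
    "nat \<Rightarrow> ('a :: {finite, ab_group_add} \<Rightarrow> complex) \<Rightarrow> (nat \<Rightarrow> 'a) \<Rightarrow> complex" where
  "autocorr n f =
     (\<lambda>t\<in>{1..<n} \<rightarrow>\<^sub>E UNIV. \<Sum>x\<in>UNIV. f x * (\<Prod>i\<in>{1..<n}. f (x + t i)))"

definition fourier ::
    "('a :: {finite, ab_group_add} \<Rightarrow> complex) \<Rightarrow> ('a \<Rightarrow> complex) \<Rightarrow> complex" where
  "fourier f e = (\<Sum>x\<in>UNIV. f x * cnj (e x))"

text \<open>
  The cyclic group of order 6 is the numeral type \<open>6\<close>, whose addition is addition modulo 6;
  \<open>Rep_bit0\<close> picks the representative in \<open>{0..<6}\<close>.  By the lemma \<open>echar_of_int\<close>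
  below the choice of representatives is immaterial.
\<close>

definition echar :: "6 \<Rightarrow> 6 \<Rightarrow> complex" where
  "echar k x =
     exp (2 * of_real pi * \<i> * of_int (Rep_bit0 k) * of_int (Rep_bit0 x) / 6)"

lemma echar_of_int:
  "echar (of_int k) (of_int m) = exp (2 * of_real pi * \<i> * of_int k * of_int m / 6)"
proof -
  define a where "a = k mod 6"
  define b where "b = m mod 6"
  have rep: "Rep_bit0 (of_int k :: 6) = a" "Rep_bit0 (of_int m :: 6) = b"
    using bit0.Rep_Abs_mod[where 'a = 3, of k] bit0.Rep_Abs_mod[where 'a = 3, of m]
    by (simp_all add: bit0.of_int_eq a_def b_def)
  have "(a * b) mod 6 = (k * m) mod 6"
    unfolding a_def b_def by (rule mod_mult_eq)
  then obtain q where q: "a * b = k * m + 6 * q"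
    by (metis mod_eqE)
  have "(of_int a * of_int b :: complex) = of_int k * of_int m + 6 * of_int q"
    using arg_cong[OF q, of "of_int :: int \<Rightarrow> complex"] by simp
  then have "2 * of_real pi * \<i> * of_int a * of_int b / 6
      = (2 * of_real pi * \<i> * of_int k * of_int m / 6 + 2 * of_int q * of_real pi * \<i> :: complex)"
    by (simp add: mult.assoc) (simp add: field_simps)
  moreover have "exp (2 * of_int q * of_real pi * \<i> :: complex) = 1"
    using cis_multiple_2pi[of "of_int q"] by (simp add: cis_conv_exp mult_ac)
  ultimately show ?thesis
    unfolding echar_def rep by (simp only: exp_add mult_1_right)
qed

definition agree_to_5_not_6 :: "(6 \<Rightarrow> complex) \<Rightarrow> (6 \<Rightarrow> complex) \<Rightarrow> bool" where
  "agree_to_5_not_6 f g \<longleftrightarrow>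
     (\<forall>n\<in>{1, 2, 3, 4, 5}. autocorr n f = autocorr n g) \<and> autocorr 6 f \<noteq> autocorr 6 g"

text \<open>Since \<open>\<omega>\<^sub>3\<^sup>2 = -1 - \<omega>\<^sub>3\<close>, the following set is the ring \<open>\<int>[\<omega>\<^sub>3]\<close>.\<close>

definition eisenstein_ints :: "complex set" where
  "eisenstein_ints = {of_int a + of_int b * exp (2 * of_real pi * \<i> / 3) | a b. True}"

definition factorizations :: "nat \<Rightarrow> complex set" where
  "factorizations L = {z \<in> eisenstein_ints. of_nat L = z * cnj z}"

lemma exp_sixth:
  "exp (2 * of_real pi * \<i> / 6) = Complex (1 / 2) (sqrt 3 / 2)"
  "exp (2 * of_real pi * \<i> / 3) = Complex (- 1 / 2) (sqrt 3 / 2)"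
proof -
  have "exp (2 * of_real pi * \<i> / 6) = cis (pi / 3)"
    by (simp add: cis_conv_exp mult_ac)
  then show "exp (2 * of_real pi * \<i> / 6) = Complex (1 / 2) (sqrt 3 / 2)"
    by (simp add: complex_eq_iff cos_60 sin_60)
  have "exp (2 * of_real pi * \<i> / 3) = cis (2 * pi / 3)"
    by (simp add: cis_conv_exp mult_ac)
  then show "exp (2 * of_real pi * \<i> / 3) = Complex (- 1 / 2) (sqrt 3 / 2)"
    by (simp add: complex_eq_iff cos_120 sin_120)
qed

lemma factorizations_eq:
  "factorizations L =
     (\<lambda>(x, y). of_int x + of_int y * exp (2 * of_real pi * \<i> / 6)) `
       {(x, y). int L = x\<^sup>2 + x * y + y\<^sup>2}"
proof -
  have shift: "of_int a + of_int b * exp (2 * of_real pi * \<i> / 3)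
      = of_int (a - b) + of_int b * exp (2 * of_real pi * \<i> / 6)" for a b
    unfolding exp_sixth by (simp add: complex_eq_iff field_simps)
  have norm: "(of_nat L = z * cnj z) \<longleftrightarrow> int L = x\<^sup>2 + x * y + y\<^sup>2"
    if z: "z = of_int x + of_int y * exp (2 * of_real pi * \<i> / 6)" for x y z
  proof -
    have "z * cnj z = of_int (x\<^sup>2 + x * y + y\<^sup>2)"
      unfolding z exp_sixth
      by (simp add: complex_eq_iff power2_eq_square algebra_simps)
    then show ?thesis
      by (metis of_int_eq_iff of_int_of_nat_eq)
  qed
  have E: "z \<in> eisenstein_ints \<longleftrightarrow>
      (\<exists>x y. z = of_int x + of_int y * exp (2 * of_real pi * \<i> / 6))" for z
  proof
    show "z \<in> eisenstein_ints \<Longrightarrow>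
        \<exists>x y. z = of_int x + of_int y * exp (2 * of_real pi * \<i> / 6)"
      unfolding eisenstein_ints_def using shift by blast
    assume "\<exists>x y. z = of_int x + of_int y * exp (2 * of_real pi * \<i> / 6)"
    then obtain x y where "z = of_int x + of_int y * exp (2 * of_real pi * \<i> / 6)"
      by blast
    then have "z = of_int (x + y) + of_int y * exp (2 * of_real pi * \<i> / 3)"
      by (subst shift) simp
    then show "z \<in> eisenstein_ints"
      unfolding eisenstein_ints_def by blast
  qed
  show ?thesis
  proof (intro equalityI subsetI)
    fix z assume "z \<in> factorizations L"
    then obtain x y where "z = of_int x + of_int y * exp (2 * of_real pi * \<i> / 6)"
      and "of_nat L = z * cnj z"
      unfolding factorizations_def E by blast
    with norm[of z x y] show "z \<in> (\<lambda>(x, y). of_int x + of_int y * exp (2 * of_real pi * \<i> / 6)) `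
       {(x, y). int L = x\<^sup>2 + x * y + y\<^sup>2}"
      by (intro image_eqI[of _ _ "(x, y)"]) simp_all
  next
    fix z assume "z \<in> (\<lambda>(x, y). of_int x + of_int y * exp (2 * of_real pi * \<i> / 6)) `
       {(x, y). int L = x\<^sup>2 + x * y + y\<^sup>2}"
    then obtain x y where "z = of_int x + of_int y * exp (2 * of_real pi * \<i> / 6)"
      and "int L = x\<^sup>2 + x * y + y\<^sup>2"
      by auto
    with norm[of z x y] show "z \<in> factorizations L"
      unfolding factorizations_def E by blast
  qed
qed

lemma finite_factorizations: "finite (factorizations L)"
proof -
  have "{(x, y). int L = x\<^sup>2 + x * y + y\<^sup>2} \<subseteq> {- 2 * int L..2 * int L} \<times> {- 2 * int L..2 * int L}"
  proof clarify
    fix x y :: int assume L: "int L = x\<^sup>2 + x * y + y\<^sup>2"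
    have bound: "\<bar>u\<bar> \<le> 2 * int L" if "u\<^sup>2 \<le> 2 * int L" for u :: int
    proof -
      have "\<bar>u\<bar> \<le> u\<^sup>2"
      proof (cases "u = 0")
        case False
        then show ?thesis
          using mult_left_mono[of 1 "\<bar>u\<bar>" "\<bar>u\<bar>"] by (simp add: power2_eq_square)
      qed simp
      with that show ?thesis by linarith
    qed
    have "0 \<le> (x + y)\<^sup>2" by simp
    then have "x\<^sup>2 + y\<^sup>2 \<le> 2 * int L"
      unfolding L by (simp add: power2_eq_square algebra_simps)
    then have "x\<^sup>2 \<le> 2 * int L" "y\<^sup>2 \<le> 2 * int L"
      using zero_le_power2[of x] zero_le_power2[of y] by linarith+
    then show "x \<in> {- 2 * int L..2 * int L} \<and> y \<in> {- 2 * int L..2 * int L}"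
      using bound[of x] bound[of y] by auto
  qed
  then have "finite {(x, y). int L = x\<^sup>2 + x * y + y\<^sup>2}"
    by (rule finite_subset) simp
  then show ?thesis
    unfolding factorizations_eq by simp
qed

text \<open>
  The natural number \<open>L\<close> is the squared modulus of the Fourier coefficient of \<open>f\<close> at \<open>e\<^sub>1\<close>, after
  that coefficient and the one of \<open>g\<close> have been multiplied by a
  common nonzero integer that moves both into \<open>\<int>[\<omega>\<^sub>3]\<close>.
\<close>

definition scaled_norm :: "(6 \<Rightarrow> complex) \<Rightarrow> (6 \<Rightarrow> complex) \<Rightarrow> nat \<Rightarrow> bool" where
  "scaled_norm f g L \<longleftrightarrow>
     (\<exists>c :: int. c \<noteq> 0
        \<and> of_int c * fourier f (echar 1) \<in> eisenstein_ints
        \<and> of_int c * fourier g (echar 1) \<in> eisenstein_ints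
        \<and> real L = (cmod (of_int c * fourier f (echar 1)))\<^sup>2)"

end

theory Submission
  imports Defs "HOL-Library.Discrete_Functions"
begin

text \<open>
  On the Fourier side, \<open>\<rho>\<^sub>n(f) = \<rho>\<^sub>n(g)\<close> says that \<open>\<Prod>i. \<phi> (k i) = \<Prod>i. \<gamma> (k i)\<close> for every
  \<open>n\<close>-tuple \<open>k\<close> in \<open>\<int>\<^sub>6\<close> with sum 0, where \<open>\<phi>\<close> and \<open>\<gamma>\<close> are the Fourier transforms of \<open>f\<close> and \<open>g\<close>.
  A 6-tuple that tells \<open>f\<close> and \<open>g\<close> apart has no shorter zero-sum subtuple if the lower
  autocorrelations agree, so it is constant, and \<open>\<phi> c ^ 6 \<noteq> \<gamma> c ^ 6\<close> for some \<open>c\<close>. The tuples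
  \<open>(0)\<close>, \<open>(2,2,2)\<close>, \<open>(3,3)\<close>, \<open>(4,4,4)\<close> leave only \<open>c = \<plusminus>1\<close>, and then \<open>(1,1,4)\<close> and \<open>(1,1,1,3)\<close> force the
  transforms to vanish at 2, 3, 4.

  For the arithmetic part, \<open>L\<close> has more than six factorizations iff two of them differ by more
  than a sixth root of unity. If a prime \<open>p \<equiv> 1 (mod 3)\<close> divides \<open>L\<close>, then \<open>p = w * cnj w\<close> and
  \<open>z = w * y\<close> for a suitable such \<open>w\<close>, and replacing the factor \<open>w\<close> by \<open>cnj w\<close> gives an essentially
  new factorization. If there is no such prime, the primes 3 and \<open>q \<equiv> 2 (mod 3)\<close> can be split off
  uniquely from every factorization.
\<close>

subsection \<open>Autocorrelations and Fourier coefficients\<close>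

lemma obtain_int6: obtains m where "(x::6) = of_int m" "0 \<le> m" "m < 6"
  by (cases x rule: bit0_cases) simp

lemma of_int6_eq_0_iff: "(of_int m :: 6) = 0 \<longleftrightarrow> 6 dvd m"
  by (simp add: of_int_eq_0_iff_char_dvd)

lemma UNIV6: "(UNIV :: 6 set) = {0, 1, 2, 3, 4, 5}"
proof -
  have "x \<in> {0, 1, 2, 3, 4, 5}" for x :: 6
  proof -
    obtain m where "x = of_int m" "0 \<le> m" "m < 6" by (rule obtain_int6)
    moreover from this have "m = 0 \<or> m = 1 \<or> m = 2 \<or> m = 3 \<or> m = 4 \<or> m = 5" by linarith
    ultimately show ?thesis by auto
  qed
  then show ?thesis by blast
qed

lemma echar_of_int_cis: "echar (of_int a) (of_int b) = cis (pi * of_int a * of_int b / 3)"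
  unfolding echar_of_int cis_conv_exp by (rule arg_cong[of _ _ exp]) simp

lemma echar_add_right: "echar k (x + y) = echar k x * echar k y"
proof -
  obtain a b c where "k = of_int a" "x = of_int b" "y = of_int c" by (meson obtain_int6)
  moreover have "echar (of_int a) (of_int (b + c)) = echar (of_int a) (of_int b) * echar (of_int a) (of_int c)"
    unfolding echar_of_int_cis cis_mult by (rule arg_cong[of _ _ cis]) (simp add: field_simps)
  ultimately show ?thesis by simp
qed

lemma echar_commute: "echar k x = echar x k"
  by (simp add: echar_def mult_ac)

lemma echar_add_left: "echar (j + k) x = echar j x * echar k x"
  by (simp add: echar_commute[of _ x] echar_add_right)

lemma echar_0_right [simp]: "echar k 0 = 1"
  by (simp add: echar_def bit0.Rep_0)

lemma echar_0_left [simp]: "echar 0 x = 1"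
  by (simp add: echar_commute[of 0])

lemma echar_sum_left: "echar (\<Sum>i\<in>A. k i) x = (\<Prod>i\<in>A. echar (k i) x)"
  by (induction A rule: infinite_finite_induct) (auto simp: echar_add_left)

lemma cnj_echar: "cnj (echar k x) = echar (- k) x"
proof -
  obtain a b where "k = of_int a" "x = of_int b" by (meson obtain_int6)
  moreover have "cnj (echar (of_int a) (of_int b)) = echar (of_int (- a)) (of_int b)"
    unfolding echar_of_int_cis cis_cnj by simp
  ultimately show ?thesis by simp
qed

lemma echar_minus_commute: "echar (- k) x = echar k (- x)"
  by (metis cnj_echar echar_commute)

lemma echar_mult_neg_left: "echar k x * echar (- k) x = 1"
  by (simp flip: echar_add_left)

lemma echar_1_eq_1_iff: "echar 1 y = 1 \<longleftrightarrow> y = 0"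
proof
  assume *: "echar 1 y = 1"
  obtain m where m: "y = of_int m" by (meson obtain_int6)
  have "cis (pi * of_int m / 3) = 1"
    using * echar_of_int_cis[of 1 m] by (simp add: m)
  then have "cos (pi * of_int m / 3) = 1"
    by (simp add: complex_eq_iff)
  then obtain n :: int where "pi * of_int m / 3 = of_int n * 2 * pi"
    by (subst (asm) cos_one_2pi_int) auto
  then have "real_of_int m = of_int (6 * n)" by (simp add: field_simps)
  then have "m = 6 * n" by (subst (asm) of_int_eq_iff)
  then show "y = 0" unfolding m of_int6_eq_0_iff by simp
qed simp

text \<open>Shifting \<open>k\<close> by 1 multiplies the sum by \<open>echar 1 y\<close>, which
  differs from 1 unless \<open>y = 0\<close>.\<close>

lemma sum_echar: "(\<Sum>k\<in>UNIV. echar k y) = (if y = 0 then 6 else 0)"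
proof -
  have "(\<Sum>k\<in>UNIV. echar k y) = (\<Sum>k\<in>UNIV. echar (1 + k) y)"
    by (rule sum.reindex_bij_witness[of _ "\<lambda>k. 1 + k" "\<lambda>k. k - 1"]) auto
  also have "\<dots> = echar 1 y * (\<Sum>k\<in>UNIV. echar k y)"
    by (simp add: echar_add_left sum_distrib_left)
  finally show ?thesis by (cases "y = 0") (simp_all add: echar_1_eq_1_iff)
qed

text \<open>By the orthogonality relation \<open>sum_echar\<close>, the double sum collapses to its
  terms with \<open>y = x\<close>.\<close>

lemma fourier_inversion: "f x = (\<Sum>k\<in>UNIV. fourier f (echar k) / 6 * echar k x)"
proof -
  have shift: "echar k (x - y) = cnj (echar k y) * echar k x" for k y
    using echar_add_right[of k x "- y"] by (simp add: cnj_echar echar_minus_commute)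
  have "(\<Sum>k\<in>UNIV. fourier f (echar k) / 6 * echar k x)
      = (\<Sum>k\<in>UNIV. \<Sum>y\<in>UNIV. f y / 6 * echar k (x - y))"
    by (simp add: fourier_def sum_distrib_right sum_distrib_left sum_divide_distrib shift mult_ac)
  also have "\<dots> = (\<Sum>y\<in>UNIV. f y / 6 * (\<Sum>k\<in>UNIV. echar k (x - y)))"
    by (subst sum.swap) (simp add: sum_distrib_left)
  also have "\<dots> = (\<Sum>y\<in>UNIV. if y = x then f y else 0)"
    by (intro sum.cong) (auto simp: sum_echar)
  finally show ?thesis by simp
qed

lemma fourier_shift: "(\<Sum>t\<in>UNIV. f (x + t) * cnj (echar k t)) = echar k x * fourier f (echar k)"
proof -
  have "(\<Sum>t\<in>UNIV. f (x + t) * cnj (echar k t)) = (\<Sum>t\<in>UNIV. echar k x * (f t * cnj (echar k t)))"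
  proof (rule sum.reindex_bij_witness[of _ "\<lambda>t. t - x" "\<lambda>t. x + t"])
    fix t show "echar k x * (f (x + t) * cnj (echar k (x + t))) = f (x + t) * cnj (echar k t)"
      using echar_mult_neg_left[of k x] by (simp add: cnj_echar echar_add_right mult_ac)
  qed auto
  then show ?thesis by (simp add: fourier_def sum_distrib_left)
qed

lemma sum_mult_echar: "(\<Sum>x\<in>UNIV. f x * echar k x) = fourier f (echar (- k))"
  by (simp add: fourier_def cnj_echar)

text \<open>For fixed \<open>x\<close> the sum over \<open>t\<close> factors into one-variable sums,
  evaluated by \<open>fourier_shift\<close>. The characters in \<open>x\<close> pulled out of them
  turn the remaining sum over \<open>x\<close> into a coefficient of \<open>f\<close> at a negated
  index.\<close>

lemma fourier_autocorr:
  "(\<Sum>t\<in>{1..<n} \<rightarrow>\<^sub>E UNIV. autocorr n f t * (\<Prod>i\<in>{1..<n}. cnj (echar (k i) (t i))))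
    = fourier f (echar (- (\<Sum>i\<in>{1..<n}. k i))) * (\<Prod>i\<in>{1..<n}. fourier f (echar (k i)))"
proof -
  have "(\<Sum>t\<in>{1..<n} \<rightarrow>\<^sub>E UNIV. autocorr n f t * (\<Prod>i\<in>{1..<n}. cnj (echar (k i) (t i))))
      = (\<Sum>t\<in>{1..<n} \<rightarrow>\<^sub>E UNIV. \<Sum>x\<in>UNIV. f x * (\<Prod>i\<in>{1..<n}. f (x + t i) * cnj (echar (k i) (t i))))"
    by (intro sum.cong) (auto simp: autocorr_def sum_distrib_right sum_distrib_left prod.distrib mult_ac)
  also have "\<dots> = (\<Sum>x\<in>UNIV. f x * (\<Prod>i\<in>{1..<n}. \<Sum>t\<in>UNIV. f (x + t) * cnj (echar (k i) t)))"
    by (subst sum.swap, subst prod_sum_PiE) (auto simp: sum_distrib_left)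
  also have "\<dots> = (\<Sum>x\<in>UNIV. f x * echar (\<Sum>i\<in>{1..<n}. k i) x) * (\<Prod>i\<in>{1..<n}. fourier f (echar (k i)))"
    by (simp add: fourier_shift prod.distrib echar_sum_left sum_distrib_right mult.assoc)
  finally show ?thesis by (simp only: sum_mult_echar)
qed

text \<open>Inverts \<open>fourier_autocorr\<close>: only the shifted factors
  \<open>f (x + t i)\<close> are expanded by \<open>fourier_inversion\<close>, while
  \<open>f x\<close> absorbs the characters in \<open>x\<close>.\<close>

lemma autocorr_conv_fourier:
  assumes "t \<in> {1..<n} \<rightarrow>\<^sub>E UNIV"
  shows "autocorr n f t = (\<Sum>k\<in>{1..<n} \<rightarrow>\<^sub>E UNIV. fourier f (echar (- (\<Sum>i\<in>{1..<n}. k i)))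
    * (\<Prod>i\<in>{1..<n}. fourier f (echar (k i))) * (\<Prod>i\<in>{1..<n}. echar (k i) (t i) / 6))"
proof -
  have "autocorr n f t = (\<Sum>x\<in>UNIV. f x * (\<Prod>i\<in>{1..<n}. \<Sum>k\<in>UNIV. fourier f (echar k) / 6 * echar k (x + t i)))"
    using assms by (simp only: autocorr_def restrict_apply' flip: fourier_inversion)
  also have "\<dots> = (\<Sum>k\<in>{1..<n} \<rightarrow>\<^sub>E UNIV. \<Sum>x\<in>UNIV. f x * (\<Prod>i\<in>{1..<n}. fourier f (echar (k i)) / 6 * echar (k i) (x + t i)))"
    by (subst prod_sum_PiE) (auto simp: sum_distrib_left intro: sum.swap)
  also have "\<dots> = (\<Sum>k\<in>{1..<n} \<rightarrow>\<^sub>E UNIV. (\<Sum>x\<in>UNIV. f x * echar (\<Sum>i\<in>{1..<n}. k i) x)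
    * (\<Prod>i\<in>{1..<n}. fourier f (echar (k i))) * (\<Prod>i\<in>{1..<n}. echar (k i) (t i) / 6))"
    by (simp add: echar_sum_left sum_distrib_left sum_distrib_right sum_divide_distrib echar_add_right
        prod.distrib prod_dividef mult_ac)
  finally show ?thesis by (simp only: sum_mult_echar)
qed

text \<open>Index 0 stands for the unshifted factor \<open>f x\<close>: a zero-sum tuple is
  determined by its entries on \<open>{1..<n}\<close>, so \<open>fourier_autocorr\<close> and
  \<open>autocorr_conv_fourier\<close> give the two directions.\<close>

lemma autocorr_eq_iff:
  assumes "n \<ge> 1"
  shows "autocorr n f = autocorr n g \<longleftrightarrow>
    (\<forall>k. (\<Sum>i<n. k i) = 0 \<longrightarrow> (\<Prod>i<n. fourier f (echar (k i))) = (\<Prod>i<n. fourier g (echar (k i))))"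
    (is "?L \<longleftrightarrow> ?R")
proof
  have n: "{..<n} = insert 0 {1..<n}" using assms by auto
  show ?R if ?L
  proof (intro allI impI)
    fix k :: "nat \<Rightarrow> 6" assume "(\<Sum>i<n. k i) = 0"
    then have k0: "- (\<Sum>i\<in>{1..<n}. k i) = k 0" by (simp add: n add_eq_0_iff)
    show "(\<Prod>i<n. fourier f (echar (k i))) = (\<Prod>i<n. fourier g (echar (k i)))"
      using fourier_autocorr[of n f k] fourier_autocorr[of n g k] that unfolding k0 n by simp
  qed
  show ?L if R: ?R
  proof
    fix t
    have eq: "fourier f (echar (- (\<Sum>i\<in>{1..<n}. k i))) * (\<Prod>i\<in>{1..<n}. fourier f (echar (k i)))
        = fourier g (echar (- (\<Sum>i\<in>{1..<n}. k i))) * (\<Prod>i\<in>{1..<n}. fourier g (echar (k i)))" for k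
    proof -
      \<comment> \<open>Changing the entry at 0 completes an arbitrary tuple to one with sum
        0.\<close>
      define k' where "k' = k(0 := - (\<Sum>i\<in>{1..<n}. k i))"
      have *: "(\<Sum>i\<in>{1..<n}. k' i) = (\<Sum>i\<in>{1..<n}. k i)"
        "(\<Prod>i\<in>{1..<n}. fourier h (echar (k' i))) = (\<Prod>i\<in>{1..<n}. fourier h (echar (k i)))" for h
        by (auto simp: k'_def)
      show ?thesis using R[rule_format, of k'] unfolding n by (simp add: *) (simp add: k'_def)
    qed
    show "autocorr n f t = autocorr n g t"
    proof (cases "t \<in> {1..<n} \<rightarrow>\<^sub>E UNIV")
      case True
      then show ?thesis by (simp only: autocorr_conv_fourier eq)
    qed (simp add: autocorr_def)
  qed
qed

text \<open>The index set is arbitrary because the argument for order 6 splits \<open>{..<6}\<close>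
  into a subset and its complement.\<close>

lemma prod_eq_if_autocorr_eq:
  assumes "autocorr (card I) f = autocorr (card I) g" "finite I" "I \<noteq> {}" "(\<Sum>i\<in>I. k i) = 0"
  shows "(\<Prod>i\<in>I. fourier f (echar (k i))) = (\<Prod>i\<in>I. fourier g (echar (k i)))"
proof -
  obtain h where h: "bij_betw h {..<card I} I"
    using ex_bij_betw_nat_finite[OF \<open>finite I\<close>] by (auto simp: atLeast0LessThan)
  have "card I \<ge> 1" using assms by (simp add: card_gt_0_iff Suc_leI)
  from autocorr_eq_iff[OF this, of f g] assms(1)
  have "(\<Sum>i<card I. k (h i)) = 0 \<longrightarrow>
     (\<Prod>i<card I. fourier f (echar (k (h i)))) = (\<Prod>i<card I. fourier g (echar (k (h i))))" by blast
  then show ?thesis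
    unfolding sum.reindex_bij_betw[OF h] prod.reindex_bij_betw[OF h, where g = "\<lambda>i. fourier f (echar (k i))"]
     prod.reindex_bij_betw[OF h, where g = "\<lambda>i. fourier g (echar (k i))"]
    using assms by blast
qed

subsection \<open>Zero-sum tuples\<close>

text \<open>
  Enumerate \<open>I\<close> starting with \<open>i, j\<close>. The proper prefix sums are distinct, so they exhaust the group
  and \<open>k j\<close> is one of them; a prefix that contains \<open>i\<close> and \<open>j\<close> would leave a zero sum after
  removing \<open>j\<close>, so the prefix is \<open>{i}\<close>.
\<close>

lemma zero_sum_free_const:
  fixes k :: "'i \<Rightarrow> 'a :: {finite, ab_group_add}"
  assumes I: "finite I" "card I = CARD('a)"
    and free: "\<And>J. J \<subset> I \<Longrightarrow> J \<noteq> {} \<Longrightarrow> sum k J \<noteq> 0"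
    and "i \<in> I" "j \<in> I"
  shows "k i = k j"
proof (rule ccontr)
  assume "k i \<noteq> k j"
  then have "i \<noteq> j" by auto
  obtain xs where xs: "set xs = I - {i, j}" "distinct xs"
    using finite_distinct_list[of "I - {i, j}"] I by auto
  define ys where "ys = i # j # xs"
  have ys: "set ys = I" "distinct ys"
    using xs assms \<open>i \<noteq> j\<close> by (auto simp: ys_def)
  then have len: "length ys = CARD('a)"
    using I distinct_card by fastforce
  define S where "S m = sum k (set (take m ys))" for m
  have take: "set (take m ys) \<subset> I" if "m < CARD('a)" for m
  proof -
    have "card (set (take m ys)) = m"
      using ys that len distinct_card[of "take m ys"] by simp
    then show ?thesis
      using that I ys set_take_subset[of m ys] by (auto simp: psubset_eq)
  qed
  \<comment> \<open>Equal prefix sums would make the segment between them a zero-sum set. The prefix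
    of full length is left out, as its sum may be 0.\<close>
  have diff: "S n \<noteq> S m" if "m < n" "n < CARD('a)" for m n
  proof
    assume "S n = S m"
    have sub: "set (take m ys) \<subseteq> set (take n ys)"
      using that by (simp add: set_take_subset_set_take)
    then have "sum k (set (take n ys) - set (take m ys)) = 0"
      using \<open>S n = S m\<close> by (simp add: sum_diff S_def)
    moreover have "set (take n ys) - set (take m ys) \<noteq> {}"
    proof -
      have "card (set (take m ys)) < card (set (take n ys))"
        using ys that len distinct_card[of "take m ys"] distinct_card[of "take n ys"] by simp
      then show ?thesis using card_mono[of "set (take m ys)" "set (take n ys)"] by auto
    qed
    ultimately show False using free[of "set (take n ys) - set (take m ys)"] take[OF that(2)] by blast
  qed
  then have "inj_on S {..<CARD('a)}"
    by (intro linorder_inj_onI) (metis lessThan_iff, auto)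
  then have "S ` {..<CARD('a)} = UNIV"
    by (intro card_subset_eq) (auto simp: card_image)
  then obtain m where m: "m < CARD('a)" "k j = S m"
    by (metis UNIV_I imageE lessThan_iff)
  have "k j \<noteq> 0"
    using free[of "{j}"] assms \<open>i \<noteq> j\<close> by auto
  then have "m \<noteq> 0" using m by (cases m) (auto simp: S_def)
  have "m \<noteq> 1" using m \<open>k i \<noteq> k j\<close> by (auto simp: S_def ys_def)
  with \<open>m \<noteq> 0\<close> have "{i, j} \<subseteq> set (take m ys)"
    by (cases m; cases "m - 1") (auto simp: ys_def)
  then have "sum k (set (take m ys) - {j}) = S m - k j"
    by (simp add: S_def sum_diff)
  then have "sum k (set (take m ys) - {j}) = 0" using m by simp
  moreover have "i \<in> set (take m ys) - {j}" using \<open>{i, j} \<subseteq> _\<close> \<open>i \<noteq> j\<close> by auto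
  ultimately show False
    using free[of "set (take m ys) - {j}"] take[OF m(1)] by blast
qed

text \<open>A proper zero-sum part of a separating 6-tuple and its complement would both be short
  zero-sum tuples, and multiplying their products would give equality. Hence
  \<open>zero_sum_free_const\<close> applies.\<close>

lemma fourier_pow6_neq:
  assumes "\<forall>n\<in>{1, 2, 3, 4, 5}. autocorr n f = autocorr n g" "autocorr 6 f \<noteq> autocorr 6 g"
  shows "\<exists>c. fourier f (echar c) ^ 6 \<noteq> fourier g (echar c) ^ 6"
proof -
  obtain k :: "nat \<Rightarrow> 6" where k: "(\<Sum>i<6. k i) = 0"
    "(\<Prod>i<6. fourier f (echar (k i))) \<noteq> (\<Prod>i<6. fourier g (echar (k i)))"
    using assms(2) autocorr_eq_iff[of 6 f g] by auto
  have short: "(\<Prod>i\<in>J. fourier f (echar (k i))) = (\<Prod>i\<in>J. fourier g (echar (k i)))"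
    if "J \<subset> {..<6}" "sum k J = 0" "J \<noteq> {}" for J
  proof -
    have "card J < 6" using psubset_card_mono[OF _ that(1)] by simp
    moreover have "card J > 0" using that finite_subset[of J "{..<6}"] by (auto simp: card_gt_0_iff)
    ultimately have "card J \<in> {1, 2, 3, 4, 5}" by auto
    then show ?thesis
      using that assms(1) finite_subset[of J "{..<6}"] by (intro prod_eq_if_autocorr_eq) auto
  qed
  have "sum k J \<noteq> 0" if J: "J \<subset> {..<6}" "J \<noteq> {}" for J
  proof
    assume 0: "sum k J = 0"
    have split: "prod h {..<6} = prod h ({..<6} - J) * prod h J" for h :: "nat \<Rightarrow> complex"
      using J by (intro prod.subset_diff) auto
    have "sum k {..<6} = sum k ({..<6} - J) + sum k J"
      using J by (intro sum.subset_diff) auto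
    then have "sum k ({..<6} - J) = 0" using 0 k by simp
    moreover have "{..<6} - J \<subset> {..<6}" "{..<6} - J \<noteq> {}" using J by auto
    ultimately show False
      using short[of "{..<6} - J"] short[of J] J 0 k(2) by (simp add: split)
  qed
  then have const: "k i = k 0" if "i < 6" for i
    using that by (intro zero_sum_free_const[of "{..<6}"]) auto
  have "(\<Prod>i<6. h (k i)) = h (k 0) ^ 6" for h :: "6 \<Rightarrow> complex"
  proof -
    have "(\<Prod>i<6. h (k i)) = (\<Prod>i<6::nat. h (k 0))"
      by (intro prod.cong refl arg_cong[of _ _ h]) (rule const, simp)
    then show ?thesis by simp
  qed
  from this[of "\<lambda>c. fourier f (echar c)"] this[of "\<lambda>c. fourier g (echar c)"] k(2)
  show ?thesis by metis
qed

section \<open>Conditions on the Fourier side for rational-valued functions\<close>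

lemma Rats_cnj: "z \<in> \<rat> \<Longrightarrow> cnj z = z"
  by (auto elim!: Rats_cases')

lemma fourier_uminus_rat:
  assumes "range f \<subseteq> \<rat>"
  shows "fourier f (echar (- k)) = cnj (fourier f (echar k))"
proof -
  have "cnj (f x) = f x" for x using assms by (intro Rats_cnj) auto
  then show ?thesis by (simp add: fourier_def cnj_echar)
qed

lemma minus_eq_6: "- 1 = (5 :: 6)" "- 2 = (4 :: 6)"
  by (rule minus_unique, simp)+

text \<open>Each numbered fact comes from one short zero-sum tuple; rationality enters through
  \<open>a (- k) = cnj (a k)\<close>.\<close>

lemma agree_imp_fourier:
  assumes rat: "range f \<subseteq> \<rat>" "range g \<subseteq> \<rat>" and agree: "agree_to_5_not_6 f g"
  shows "fourier f (echar 0) = fourier g (echar 0)"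
    and "k \<in> {2, 3, 4} \<Longrightarrow> fourier f (echar k) = 0 \<and> fourier g (echar k) = 0"
    and "cmod (fourier f (echar 1)) = cmod (fourier g (echar 1))"
    and "fourier f (echar 1) ^ 6 \<noteq> fourier g (echar 1) ^ 6"
proof -
  define a where "a k = fourier f (echar k)" for k
  define b where "b k = fourier g (echar k)" for k
  have short: "prod_list (map a ks) = prod_list (map b ks)"
    if "length ks \<in> {1, 2, 3, 4, 5}" "sum_list ks = 0" for ks
  proof -
    have "autocorr (length ks) f = autocorr (length ks) g"
      using agree that(1) unfolding agree_to_5_not_6_def by blast
    moreover have "{..<length ks} \<noteq> {}" using that(1) unfolding lessThan_empty_iff by auto
    ultimately have "(\<Prod>i<length ks. a (ks ! i)) = (\<Prod>i<length ks. b (ks ! i))"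
      using that(2) prod_eq_if_autocorr_eq[of "{..<length ks}" f g "\<lambda>i. ks ! i"]
      by (simp add: sum_list_sum_nth atLeast0LessThan a_def b_def)
    then show ?thesis by (simp add: prod.list_conv_set_nth atLeast0LessThan)
  qed
  have 0: "a 0 = b 0" using short[of "[0]"] by simp
  have 3: "a 3 ^ 2 = b 3 ^ 2" using short[of "[3, 3]"] by (simp add: power2_eq_square)
  have 2: "a 2 ^ 3 = b 2 ^ 3" using short[of "[2, 2, 2]"] by (simp add: power3_eq_cube mult.assoc)
  have 4: "a 4 ^ 3 = b 4 ^ 3" using short[of "[4, 4, 4]"] by (simp add: power3_eq_cube mult.assoc)
  have 15: "a 1 * a 5 = b 1 * b 5" using short[of "[1, 5]"] by simp
  have 114: "a 1 ^ 2 * a 4 = b 1 ^ 2 * b 4" using short[of "[1, 1, 4]"] by (simp add: power2_eq_square mult.assoc)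
  have 1113: "a 1 ^ 3 * a 3 = b 1 ^ 3 * b 3" using short[of "[1, 1, 1, 3]"] by (simp add: power3_eq_cube mult.assoc)
  have neg: "a (- k) = cnj (a k)" "b (- k) = cnj (b k)" for k
    unfolding a_def b_def using rat by (auto intro: fourier_uminus_rat)
  have a24: "a 4 = cnj (a 2)" "b 4 = cnj (b 2)" "a 5 = cnj (a 1)" "b 5 = cnj (b 1)"
    using neg[of 2] neg[of 1] unfolding minus_eq_6 by simp_all
  \<comment> \<open>The short tuples and conjugation carry equality of sixth powers from 1 to the
    whole group, against \<open>fourier_pow6_neq\<close>.\<close>
  have neq: "a 1 ^ 6 \<noteq> b 1 ^ 6"
  proof
    assume 1: "a 1 ^ 6 = b 1 ^ 6"
    have pow6: "u ^ 6 = v ^ 6" if "u ^ 2 = v ^ 2 \<or> u ^ 3 = v ^ 3" for u v :: complex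
    proof -
      have "w ^ 6 = (w ^ 2) ^ 3" "w ^ 6 = (w ^ 3) ^ 2" for w :: complex
        by (simp_all flip: power_mult)
      then show ?thesis using that by metis
    qed
    have "a 5 ^ 6 = b 5 ^ 6"
      unfolding a24 complex_cnj_power[symmetric] 1 ..
    moreover have "a 2 ^ 6 = b 2 ^ 6" "a 3 ^ 6 = b 3 ^ 6" "a 4 ^ 6 = b 4 ^ 6"
      using pow6 2 3 4 by blast+
    ultimately have "\<forall>c\<in>UNIV. a c ^ 6 = b c ^ 6"
      unfolding UNIV6 using 0 1 by simp
    then show False
      using fourier_pow6_neq[of f g] agree unfolding a_def b_def agree_to_5_not_6_def by blast
  qed
  \<comment> \<open>Otherwise, squaring \<open>1113\<close> and cancelling
    \<open>a 3 ^ 2 = b 3 ^ 2\<close> gives equal sixth powers at 1.\<close>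
  have "a 3 = 0"
  proof (rule ccontr)
    assume "a 3 \<noteq> 0"
    have "a 1 ^ 6 * a 3 ^ 2 = (a 1 ^ 3 * a 3) ^ 2" by (simp add: power_mult_distrib flip: power_mult)
    also have "\<dots> = b 1 ^ 6 * a 3 ^ 2" unfolding 1113 3 by (simp add: power_mult_distrib flip: power_mult)
    finally show False using neq \<open>a 3 \<noteq> 0\<close> by simp
  qed
  \<comment> \<open>The same with the cube of \<open>114\<close> and
    \<open>a 4 ^ 3 = b 4 ^ 3\<close>.\<close>
  have "a 4 = 0"
  proof (rule ccontr)
    assume "a 4 \<noteq> 0"
    have "a 1 ^ 6 * a 4 ^ 3 = (a 1 ^ 2 * a 4) ^ 3" by (simp add: power_mult_distrib flip: power_mult)
    also have "\<dots> = b 1 ^ 6 * a 4 ^ 3" unfolding 114 4 by (simp add: power_mult_distrib flip: power_mult)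
    finally show False using neq \<open>a 4 \<noteq> 0\<close> by simp
  qed
  have "b 3 = 0" "b 4 = 0" using 3 4 \<open>a 3 = 0\<close> \<open>a 4 = 0\<close> by auto
  show "fourier f (echar 0) = fourier g (echar 0)" using 0 by (simp add: a_def b_def)
  show "fourier f (echar 1) ^ 6 \<noteq> fourier g (echar 1) ^ 6" using neq by (simp add: a_def b_def)
  show "fourier f (echar k) = 0 \<and> fourier g (echar k) = 0" if "k \<in> {2, 3, 4}"
    using that a24 \<open>a 3 = 0\<close> \<open>a 4 = 0\<close> \<open>b 3 = 0\<close> \<open>b 4 = 0\<close> unfolding a_def[symmetric] b_def[symmetric] by auto
  have "(cmod (a 1))\<^sup>2 = (cmod (b 1))\<^sup>2"
    using 15 unfolding a24 complex_norm_square[symmetric] of_real_eq_iff .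
  then show "cmod (fourier f (echar 1)) = cmod (fourier g (echar 1))"
    by (simp add: a_def b_def)
qed

text \<open>\<open>m + n * 5\<close> is congruent to \<open>m - n\<close> modulo 6, and
  \<open>m - n\<close> lies between -5 and 5.\<close>

lemma eq_if_6_dvd:
  fixes m n :: nat
  assumes "6 dvd int m + int n * 5" "m + n \<le> 5"
  shows "m = n"
proof -
  have "a = b" if "6 dvd a + b * 5" "a + b \<le> 5" "0 \<le> a" "0 \<le> b" for a b :: int
    using that by presburger
  from this[of "int m" "int n"] show ?thesis using assms by simp
qed

text \<open>A short zero-sum tuple that meets 2, 3 or 4 has both products 0. Any other consists of
  0, 1, 5 with as many 1s as 5s, so its product involves only the value at 0 and the product of the
  values at 1 and 5, where the transforms agree.\<close>

lemma fourier_imp_agree: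
  assumes rat: "range f \<subseteq> \<rat>" "range g \<subseteq> \<rat>"
    and 0: "fourier f (echar 0) = fourier g (echar 0)"
    and 234: "\<forall>k\<in>{2, 3, 4}. fourier f (echar k) = 0 \<and> fourier g (echar k) = 0"
    and norm: "cmod (fourier f (echar 1)) = cmod (fourier g (echar 1))"
    and neq: "fourier f (echar 1) ^ 6 \<noteq> fourier g (echar 1) ^ 6"
  shows "agree_to_5_not_6 f g"
proof -
  define a where "a k = fourier f (echar k)" for k
  define b where "b k = fourier g (echar k)" for k
  have a5: "a 5 = cnj (a 1)" "b 5 = cnj (b 1)"
    using fourier_uminus_rat[OF rat(1), of 1] fourier_uminus_rat[OF rat(2), of 1]
    unfolding minus_eq_6 a_def b_def by simp_all
  have 15: "a 1 * a 5 = b 1 * b 5"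
    unfolding a5 complex_norm_square[symmetric] using norm by (simp add: a_def b_def)
  have "(\<Prod>i<n. a (k i)) = (\<Prod>i<n. b (k i))" if "n \<le> 5" "(\<Sum>i<n. k i) = 0" for n :: nat and k
  proof (cases "\<exists>i<n. k i \<in> {2, 3, 4}")
    case True
    then obtain i where "i < n" and "k i \<in> {2, 3, 4}" by blast
    moreover from this have "a (k i) = 0" "b (k i) = 0"
      using 234 unfolding a_def b_def by blast+
    ultimately have "\<exists>i\<in>{..<n}. a (k i) = 0" "\<exists>i\<in>{..<n}. b (k i) = 0" by blast+
    from this[THEN prod_zero[OF finite_lessThan]] show ?thesis by metis
  next
    case False
    define N where "N c = {i. i < n \<and> k i = c}" for c
    have part: "{..<n} = N 0 \<union> (N 1 \<union> N 5)"
    proof -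
      have "k i = 0 \<or> k i = 1 \<or> k i = 5" if "i < n" for i
      proof -
        have "k i \<in> {0, 1, 2, 3, 4, 5}" using UNIV6 by blast
        moreover have "k i \<notin> {2, 3, 4}" using False that by blast
        ultimately show ?thesis by blast
      qed
      then show ?thesis unfolding N_def by blast
    qed
    have [simp]: "finite (N c)" for c by (simp add: N_def)
    have disj: "N 0 \<inter> (N 1 \<union> N 5) = {}" "N 1 \<inter> N 5 = {}" by (auto simp: N_def)
    have prod: "(\<Prod>i<n. h (k i)) = h 0 ^ card (N 0) * (h 1 ^ card (N 1) * h 5 ^ card (N 5))"
      for h :: "6 \<Rightarrow> complex"
    proof -
      have "(\<Prod>i\<in>N c. h (k i)) = h c ^ card (N c)" for c
        by (simp add: N_def)
      then show ?thesis unfolding part using disj by (simp add: prod.union_disjoint)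
    qed
    have "(\<Sum>i\<in>N c. k i) = of_nat (card (N c)) * c" for c
      by (simp add: N_def)
    then have "(\<Sum>i<n. k i) = of_nat (card (N 1)) + of_nat (card (N 5)) * 5"
      unfolding part using disj by (simp add: sum.union_disjoint)
    also have "\<dots> = of_int (int (card (N 1)) + int (card (N 5)) * 5)" by simp
    finally have "(of_int (int (card (N 1)) + int (card (N 5)) * 5) :: 6) = 0"
      unfolding that(2) by (rule sym)
    then have "6 dvd int (card (N 1)) + int (card (N 5)) * 5"
      unfolding of_int6_eq_0_iff .
    moreover have "card (N 1) + card (N 5) \<le> 5"
    proof -
      have "card (N 1 \<union> N 5) \<le> card {..<n}" by (intro card_mono) (auto simp: N_def)
      then show ?thesis using that disj by (simp add: card_Un_disjoint)
    qed
    ultimately have "card (N 1) = card (N 5)"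
      by (rule eq_if_6_dvd)
    then have eq: "(\<Prod>i<n. h (k i)) = h 0 ^ card (N 0) * (h 1 * h 5) ^ card (N 1)"
      for h :: "6 \<Rightarrow> complex"
      unfolding prod by (simp add: power_mult_distrib)
    have "a 0 = b 0" using 0 unfolding a_def b_def .
    then show ?thesis unfolding eq[of a] eq[of b] 15 by simp
  qed
  then have "autocorr n f = autocorr n g" if "1 \<le> n" "n \<le> 5" for n
    unfolding autocorr_eq_iff[OF that(1)] using that(2) unfolding a_def b_def by simp
  then have "\<forall>n\<in>{1, 2, 3, 4, 5}. autocorr n f = autocorr n g" by simp
  moreover have "autocorr 6 f \<noteq> autocorr 6 g"
  proof
    assume *: "autocorr 6 f = autocorr 6 g"
    \<comment> \<open>The constant tuple 1 of length 6 isolates the sixth powers.\<close>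
    have sum0: "(\<Sum>i<6::nat. (1::6)) = 0" by simp
    have "(\<Prod>i<6::nat. fourier f (echar 1)) = (\<Prod>i<6::nat. fourier g (echar 1))"
      using autocorr_eq_iff[of 6 f g, THEN iffD1, OF _ *, rule_format, OF _ sum0] by simp
    with neq show False by simp
  qed
  ultimately show ?thesis unfolding agree_to_5_not_6_def by blast
qed

subsection \<open>Factorizations in the Eisenstein integers\<close>

text \<open>Coordinates with respect to 1 and the primitive sixth root of unity, in which the norm
  is the form \<open>x\<^sup>2 + x * y + y\<^sup>2\<close>.\<close>

definition eis :: "int \<Rightarrow> int \<Rightarrow> complex" where
  "eis x y = of_int x + of_int y * exp (2 * of_real pi * \<i> / 6)"

lemma eis_eq: "eis x y = Complex (x + y / 2) (y * sqrt 3 / 2)"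
  unfolding eis_def exp_sixth by (simp add: complex_eq_iff)

lemma eis_inject: "eis a b = eis c d \<longleftrightarrow> a = c \<and> b = d"
  by (auto simp: eis_eq)

lemma eis_add: "eis a b + eis c d = eis (a + c) (b + d)"
  by (simp add: eis_eq complex_eq_iff field_simps)

lemma eis_mult: "eis a b * eis c d = eis (a * c - b * d) (a * d + b * c + b * d)"
  by (simp add: eis_eq complex_eq_iff field_simps)

lemma eis_of_int: "eis a 0 = of_int a"
  by (simp add: eis_def)

lemma cnj_eis: "cnj (eis a b) = eis (a + b) (- b)"
  by (simp add: eis_eq complex_eq_iff field_simps)

lemma eis_mult_cnj: "eis a b * cnj (eis a b) = of_int (a\<^sup>2 + a * b + b\<^sup>2)"
  by (simp add: cnj_eis eis_mult eis_inject power2_eq_square algebra_simps flip: eis_of_int)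

lemma eisenstein_ints_iff: "z \<in> eisenstein_ints \<longleftrightarrow> (\<exists>x y. z = eis x y)"
proof -
  have "of_int a + of_int b * exp (2 * of_real pi * \<i> / 3) = eis (a - b) b" for a b
    unfolding exp_sixth by (simp add: eis_eq complex_eq_iff field_simps)
  moreover have "eis x y = eis ((x + y) - y) y" for x y by simp
  ultimately show ?thesis unfolding eisenstein_ints_def by (auto, metis)
qed

lemma eisenstein_ints_mult: "z \<in> eisenstein_ints \<Longrightarrow> w \<in> eisenstein_ints \<Longrightarrow> z * w \<in> eisenstein_ints"
  unfolding eisenstein_ints_iff by (metis eis_mult)

lemma eisenstein_ints_cnj: "z \<in> eisenstein_ints \<Longrightarrow> cnj z \<in> eisenstein_ints"
  unfolding eisenstein_ints_iff by (metis cnj_eis)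

lemma eisenstein_ints_sum:
  "(\<And>x. x \<in> A \<Longrightarrow> h x \<in> eisenstein_ints) \<Longrightarrow> sum h A \<in> eisenstein_ints"
proof (induction A rule: infinite_finite_induct)
  case (insert x A)
  then have "h x \<in> eisenstein_ints" "sum h A \<in> eisenstein_ints" by auto
  with insert(1,2) show ?case unfolding eisenstein_ints_iff by (simp, metis eis_add)
qed (use eis_of_int[of 0] in \<open>auto simp: eisenstein_ints_iff intro!: exI[of _ 0]\<close>)

lemma eis_in_factorizations_iff: "eis x y \<in> factorizations L \<longleftrightarrow> int L = x\<^sup>2 + x * y + y\<^sup>2"
proof -
  have "eis x y \<in> factorizations L \<longleftrightarrow> (of_int (int L) :: complex) = of_int (x\<^sup>2 + x * y + y\<^sup>2)"
    unfolding factorizations_def eis_mult_cnj[symmetric] by (auto simp: eisenstein_ints_iff)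
  then show ?thesis by (simp only: of_int_eq_iff)
qed

lemma in_factorizationsE:
  assumes "z \<in> factorizations L"
  obtains x y where "z = eis x y" "int L = x\<^sup>2 + x * y + y\<^sup>2"
proof -
  obtain x y where "z = eis x y"
    using assms unfolding factorizations_def eisenstein_ints_iff by auto
  then show ?thesis using assms that eis_in_factorizations_iff by blast
qed

lemma in_factorizations_iff_cmod:
  "z \<in> factorizations L \<longleftrightarrow> z \<in> eisenstein_ints \<and> real L = (cmod z)\<^sup>2"
proof -
  have "of_nat L = complex_of_real (real L)" by simp
  then show ?thesis unfolding factorizations_def complex_norm_square[symmetric]
    by (simp only: mem_Collect_eq of_real_eq_iff)
qed

lemma cmod_eisenstein_square:
  assumes "z \<in> eisenstein_ints"
  obtains L :: nat where "real L = (cmod z)\<^sup>2"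
proof -
  obtain x y where z: "z = eis x y" using assms by (auto simp: eisenstein_ints_iff)
  have "complex_of_real ((cmod z)\<^sup>2) = of_real (of_int (x\<^sup>2 + x * y + y\<^sup>2))"
    unfolding complex_norm_square z eis_mult_cnj by simp
  then have *: "(cmod z)\<^sup>2 = of_int (x\<^sup>2 + x * y + y\<^sup>2)" by (simp only: of_real_eq_iff)
  then have "(0::real) \<le> of_int (x\<^sup>2 + x * y + y\<^sup>2)" by (metis zero_le_power2)
  then have "real (nat (x\<^sup>2 + x * y + y\<^sup>2)) = (cmod z)\<^sup>2"
    unfolding * of_int_0_le_iff by (simp only: of_nat_nat)
  then show ?thesis by (rule that)
qed

text \<open>The six listed numbers are sixth roots of unity, and there are exactly six of
  these.\<close>

lemma sixth_root_of_unity_iff: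
  "z ^ 6 = 1 \<longleftrightarrow> z \<in> {eis 1 0, eis 0 1, eis (-1) 1, eis (-1) 0, eis 0 (-1), eis 1 (-1)}"
    (is "_ \<longleftrightarrow> z \<in> ?U")
proof -
  have pow: "z ^ 6 = ((z * z) * z) * ((z * z) * z)" for z :: complex
    by (simp add: eval_nat_numeral)
  have "u ^ 6 = 1" if "u \<in> ?U" for u
    using that by (auto simp: pow eis_mult) (auto simp: eis_of_int)
  then have "?U \<subseteq> {z. z ^ 6 = 1}" by blast
  moreover have "card ?U = 6" by (simp add: eis_inject)
  moreover have "card {z::complex. z ^ 6 = 1} = 6" by (rule card_roots_unity_eq) simp
  ultimately have "?U = {z. z ^ 6 = 1}" by (intro card_subset_eq) (auto intro: card_ge_0_finite)
  then show ?thesis by blast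
qed

lemma sixth_root_of_unity_eisenstein: "z ^ 6 = 1 \<Longrightarrow> z \<in> eisenstein_ints"
  unfolding sixth_root_of_unity_iff eisenstein_ints_iff by blast

lemma factorizations_0: "factorizations 0 = {0}"
  by (auto simp: factorizations_def eisenstein_ints_iff eis_def intro!: exI[of _ 0])

text \<open>Factorizations with a common sixth power lie among the six roots of one equation.
  Conversely, all six unit multiples of \<open>z\<close> are factorizations, and \<open>w\<close> is
  a seventh.\<close>

lemma card_factorizations_gt_6_iff:
  "card (factorizations L) > 6 \<longleftrightarrow> (\<exists>z\<in>factorizations L. \<exists>w\<in>factorizations L. z ^ 6 \<noteq> w ^ 6)"
proof
  assume card: "card (factorizations L) > 6"
  show "\<exists>z\<in>factorizations L. \<exists>w\<in>factorizations L. z ^ 6 \<noteq> w ^ 6"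
  proof (rule ccontr)
    assume *: "\<not> ?thesis"
    obtain z where z: "z \<in> factorizations L" using card by fastforce
    have "z \<noteq> 0"
    proof
      assume "z = 0"
      with z have "L = 0" by (simp add: factorizations_def)
      with card show False by (simp add: factorizations_0)
    qed
    then have "card {w. w ^ 6 = z ^ 6} = 6" by (intro card_nth_roots) auto
    moreover have "factorizations L \<subseteq> {w. w ^ 6 = z ^ 6}" using * z by blast
    ultimately show False
      using card card_mono[of "{w. w ^ 6 = z ^ 6}" "factorizations L"] by (simp add: card_ge_0_finite)
  qed
next
  assume "\<exists>z\<in>factorizations L. \<exists>w\<in>factorizations L. z ^ 6 \<noteq> w ^ 6"
  then obtain z w where zw: "z \<in> factorizations L" "w \<in> factorizations L" "z ^ 6 \<noteq> w ^ 6" by blast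
  have "z \<noteq> 0"
  proof
    assume "z = 0"
    with zw have "L = 0" by (simp add: factorizations_def)
    with zw show False by (simp add: factorizations_0)
  qed
  have "u \<in> factorizations L" if "u ^ 6 = z ^ 6" for u
  proof -
    have "(u / z) ^ 6 = 1" using that \<open>z \<noteq> 0\<close> by (simp add: power_divide)
    then have "u / z \<in> eisenstein_ints" by (rule sixth_root_of_unity_eisenstein)
    then have "(u / z) * z \<in> eisenstein_ints"
      using zw(1) by (intro eisenstein_ints_mult) (auto simp: factorizations_def)
    moreover have "cmod u ^ 6 = cmod z ^ 6" using that by (metis norm_power)
    then have "cmod u = cmod z" by (simp add: power_eq_iff_eq_base)
    ultimately show ?thesis using zw(1) \<open>z \<noteq> 0\<close> by (simp add: in_factorizations_iff_cmod)
  qed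
  then have "insert w {u. u ^ 6 = z ^ 6} \<subseteq> factorizations L" using zw(2) by blast
  then have "card (insert w {u. u ^ 6 = z ^ 6}) \<le> card (factorizations L)"
    by (intro card_mono finite_factorizations)
  moreover have "card {u. u ^ 6 = z ^ 6} = 6" using \<open>z \<noteq> 0\<close> by (intro card_nth_roots) auto
  ultimately show "card (factorizations L) > 6"
    using zw(3) by (subst (asm) card_insert_disjoint) (auto simp: card_ge_0_finite)
qed

section \<open>Primes modulo 3 and their effect on factorizations\<close>

lemma fermat_theorem_int:
  assumes "prime p" "\<not> int p dvd a"
  shows "[a ^ (p - 1) = 1] (mod int p)"
proof -
  have p: "p > 0" using assms by (simp add: prime_gt_0_nat)
  define b where "b = nat (a mod int p)"
  have b: "int b = a mod int p" using p by (simp add: b_def)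
  have "\<not> p dvd b"
    using assms(2) b by (metis dvd_mod_iff dvd_refl int_dvd_int_iff)
  then have "[b ^ (p - 1) = 1] (mod p)" by (rule fermat_theorem[OF assms(1)])
  then have "[int b ^ (p - 1) = 1] (mod int p)" by (metis cong_int_iff of_nat_1 of_nat_power)
  moreover have "[int b ^ (p - 1) = a ^ (p - 1)] (mod int p)"
    by (intro cong_pow) (simp add: b cong_def)
  ultimately show ?thesis using cong_sym cong_trans by blast
qed

text \<open>Cubing is injective on the units modulo \<open>q\<close>, and
  \<open>x ^ 3 - y ^ 3\<close> is a multiple of the norm. So if \<open>q\<close> divides neither
  entry, \<open>x\<close> and \<open>y\<close> are congruent and the norm reduces to
  \<open>3 * y\<^sup>2\<close>, which \<open>q\<close> cannot divide.\<close>

lemma inert_prime_dvd: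
  fixes x y :: int
  assumes q: "prime q" "[q = 2] (mod 3)" and dvd: "int q dvd x\<^sup>2 + x * y + y\<^sup>2"
  shows "int q dvd x \<and> int q dvd y"
proof -
  have pq: "prime (int q)" using q by simp
  have sym: "int q dvd v" if "int q dvd u" "int q dvd u\<^sup>2 + u * v + v\<^sup>2" for u v
  proof -
    have "u\<^sup>2 + u * v + v\<^sup>2 = u * (u + v) + v\<^sup>2" by (simp add: power2_eq_square algebra_simps)
    then have "int q dvd v\<^sup>2" using that by (metis dvd_add_right_iff dvd_mult2)
    then show ?thesis using pq prime_dvd_power by blast
  qed
  have "int q dvd x \<or> int q dvd y"
  proof (rule ccontr)
    assume *: "\<not> ?thesis"
    obtain m where m: "q = 3 * m + 2"
    proof
      have "q mod 3 = 2" using q(2) by (simp add: cong_def)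
      then show "q = 3 * (q div 3) + 2" by presburger
    qed
    have "x ^ 3 - y ^ 3 = (x - y) * (x\<^sup>2 + x * y + y\<^sup>2)"
      by (simp add: power3_eq_cube power2_eq_square algebra_simps)
    then have "[x ^ 3 = y ^ 3] (mod int q)" using dvd by (simp add: cong_iff_dvd_diff)
    then have cube: "[(x ^ 3) ^ m = (y ^ 3) ^ m] (mod int q)" by (rule cong_pow)
    \<comment> \<open>Since \<open>q - 1 = 3 * m + 1\<close>, Fermat makes \<open>x\<close> the
      inverse of a power of its cube, and equal cubes have equal inverses.\<close>
    have "[(x ^ 3) ^ m * x = 1] (mod int q)" "[(y ^ 3) ^ m * y = 1] (mod int q)"
      using fermat_theorem_int[OF q(1)] * by (auto simp: m mult.commute simp flip: power_mult)
    then have "[(x ^ 3) ^ m * x = (x ^ 3) ^ m * y] (mod int q)"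
      using cube by (meson cong_scalar_right cong_sym cong_trans)
    moreover have "coprime ((x ^ 3) ^ m) (int q)"
      using * prime_imp_coprime[OF pq, of x] by (simp add: coprime_commute)
    ultimately have "[x = y] (mod int q)" using cong_mult_lcancel by blast
    then obtain k where k: "x = y + int q * k"
      by (metis cong_iff_lin cong_sym mult.commute)
    have "x\<^sup>2 + x * y + y\<^sup>2 = 3 * y\<^sup>2 + int q * (k * (3 * y + int q * k))"
      unfolding k by (simp add: power2_eq_square algebra_simps)
    then have "int q dvd 3 * y\<^sup>2" using dvd by (metis dvd_add_left_iff dvd_triv_left)
    then have "int q dvd 3 \<or> int q dvd y" using pq prime_dvd_mult_iff prime_dvd_power by blast
    with * have "int q dvd 3" by simp
    then have "q dvd 3" by (metis int_dvd_int_iff of_nat_numeral)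
    then have "q \<le> 3" by (intro dvd_imp_le) auto
    with m have "q = 2" by simp
    with \<open>q dvd 3\<close> show False by simp
  qed
  then show ?thesis using sym[of x y] sym[of y x] dvd by (auto simp: algebra_simps)
qed

text \<open>Strong induction: for a prime divisor \<open>q\<close> of \<open>L\<close>, all
  factorizations share a factor \<open>d\<close>, and the quotients factor one smaller
  \<open>M\<close>. For \<open>q = 3\<close> it is \<open>d = eis 1 1\<close>, of norm 3; otherwise
  \<open>d = q\<close>.\<close>

lemma factorizations_pow6_unique:
  assumes "L > 0" "\<And>p. prime p \<Longrightarrow> p dvd L \<Longrightarrow> \<not> [p = 1] (mod 3)"
    and "z \<in> factorizations L" "w \<in> factorizations L"
  shows "z ^ 6 = w ^ 6"
  using assms
proof (induction L arbitrary: z w rule: less_induct)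
  case (less L)
  show ?case
  proof (cases "L = 1")
    case True
    have "u ^ 6 = 1" if u: "u \<in> factorizations 1" for u
    proof -
      obtain x y where xy: "u = eis x y" "int 1 = x\<^sup>2 + x * y + y\<^sup>2"
        using u by (rule in_factorizationsE)
      \<comment> \<open>Completing the square in four times the norm bounds both coordinates, so
        only the six units have norm 1.\<close>
      have "(2 * x + y)\<^sup>2 + 3 * y\<^sup>2 = 4" using xy(2) by (simp add: power2_eq_square algebra_simps)
      then have "y\<^sup>2 < 4" using zero_le_power2[of "2 * x + y"] by linarith
      then have "\<bar>y\<bar> < 2" using power2_less_imp_less[of "\<bar>y\<bar>" 2] by simp
      then have "y = -1 \<or> y = 0 \<or> y = 1" by linarith
      moreover have "(2 * y + x)\<^sup>2 + 3 * x\<^sup>2 = 4" using xy(2) by (simp add: power2_eq_square algebra_simps)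
      then have "x\<^sup>2 < 4" using zero_le_power2[of "2 * y + x"] by linarith
      then have "\<bar>x\<bar> < 2" using power2_less_imp_less[of "\<bar>x\<bar>" 2] by simp
      then have "x = -1 \<or> x = 0 \<or> x = 1" by linarith
      ultimately show ?thesis using xy(2) unfolding sixth_root_of_unity_iff xy(1) by auto
    qed
    then show ?thesis using less.prems True by metis
  next
    case False
    then obtain q where q: "prime q" "q dvd L" using prime_factor_nat by blast
    have "\<exists>d M. M < L \<and> M > 0 \<and> M dvd L \<and> (\<forall>z\<in>factorizations L. \<exists>z'\<in>factorizations M. z = d * z')"
    proof (cases "q = 3")
      case True
      have "\<exists>z'\<in>factorizations (L div 3). z = eis 1 1 * z'" if z: "z \<in> factorizations L" for z
      proof -
        obtain x y where xy: "z = eis x y" "int L = x\<^sup>2 + x * y + y\<^sup>2"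
          using z by (rule in_factorizationsE)
        have L3: "int L = 3 * int (L div 3)" using q True by auto
        \<comment> \<open>The norm is \<open>(x - y)\<^sup>2 + 3 * x * y\<close>, so 3 divides
          \<open>x - y\<close>; this is what makes \<open>z\<close> divisible by
          \<open>eis 1 1\<close>.\<close>
        have "(x - y) * (x - y) = 3 * (int (L div 3) - x * y)"
          using xy(2) unfolding L3 by (simp add: power2_eq_square algebra_simps)
        then have "3 dvd (x - y) * (x - y)" by simp
        then have "3 dvd x - y" by (subst (asm) prime_dvd_mult_iff) auto
        then obtain m where "x - y = 3 * m" by blast
        then have m: "x = y + 3 * m" by simp
        have "3 * int (L div 3) = 3 * ((y + 2 * m)\<^sup>2 + (y + 2 * m) * (- m) + (- m)\<^sup>2)"
          using xy(2) unfolding L3 m by (simp add: power2_eq_square algebra_simps)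
        then have "eis (y + 2 * m) (- m) \<in> factorizations (L div 3)"
          unfolding eis_in_factorizations_iff by simp
        moreover have "z = eis 1 1 * eis (y + 2 * m) (- m)" by (simp add: xy m eis_mult eis_inject)
        ultimately show ?thesis by blast
      qed
      moreover have "L div 3 < L" "L div 3 > 0" "L div 3 dvd L" using q True less.prems(1) by auto
      ultimately show ?thesis by blast
    next
      case False
      have "\<not> 3 dvd q" using q(1) False primes_dvd_imp_eq[of 3 q] by auto
      then have "q mod 3 = 1 \<or> q mod 3 = 2" by presburger
      then have q2: "[q = 2] (mod 3)" using less.prems(2)[OF q] by (auto simp: cong_def)
      have div: "\<exists>x' y'. z = eis (int q * x') (int q * y') \<and> int L = (int q)\<^sup>2 * (x'\<^sup>2 + x' * y' + y'\<^sup>2)"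
        if z: "z \<in> factorizations L" for z
      proof -
        obtain x y where xy: "z = eis x y" "int L = x\<^sup>2 + x * y + y\<^sup>2"
          using z by (rule in_factorizationsE)
        then have "int q dvd x\<^sup>2 + x * y + y\<^sup>2" using q(2) by (metis int_dvd_int_iff)
        then obtain x' y' where "x = int q * x'" "y = int q * y'"
          using inert_prime_dvd[OF q(1) q2, of x y] by (auto elim!: dvdE)
        then show ?thesis using xy by (auto simp: power2_eq_square algebra_simps intro!: exI[of _ x', OF exI[of _ y']])
      qed
      \<comment> \<open>The given factorization \<open>z\<close> is what shows that even
        \<open>q\<^sup>2\<close> divides \<open>L\<close>.\<close>
      obtain x0 y0 where "int L = (int q)\<^sup>2 * (x0\<^sup>2 + x0 * y0 + y0\<^sup>2)" using div[OF less.prems(3)] by blast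
      then have "int (q\<^sup>2) dvd int L" by simp
      then have "q\<^sup>2 dvd L" by (simp only: int_dvd_int_iff)
      then obtain M where M: "L = q\<^sup>2 * M" by blast
      have "\<exists>z'\<in>factorizations M. z = of_int (int q) * z'" if z: "z \<in> factorizations L" for z
      proof -
        obtain x y where xy: "z = eis (int q * x) (int q * y)" "int L = (int q)\<^sup>2 * (x\<^sup>2 + x * y + y\<^sup>2)"
          using div[OF z] by blast
        then have "int M = x\<^sup>2 + x * y + y\<^sup>2" using prime_gt_0_nat[OF q(1)] by (simp add: M)
        then show ?thesis
          using xy(1) unfolding eis_in_factorizations_iff[symmetric]
          by (intro bexI[of _ "eis x y"]) (simp_all add: eis_mult flip: eis_of_int)
      qed
      moreover have "M > 0" "M dvd L" using M less.prems(1) by auto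
      moreover have "1 < q\<^sup>2" using prime_gt_1_nat[OF q(1)] by (simp add: power2_eq_square one_less_mult)
      then have "M < L" using M \<open>M > 0\<close> by simp
      ultimately show ?thesis by blast
    qed
    then obtain d M where M: "M < L" "M > 0" "M dvd L"
      and div: "\<forall>z\<in>factorizations L. \<exists>z'\<in>factorizations M. z = d * z'" by blast
    obtain z' w' where "z' \<in> factorizations M" "w' \<in> factorizations M" "z = d * z'" "w = d * w'"
      using div less.prems by meson
    moreover from this have "z' ^ 6 = w' ^ 6"
      using less.prems(2) M dvd_trans by (intro less.IH[OF M(1,2)]) blast+
    ultimately show ?thesis by (simp add: power_mult_distrib)
  qed
qed

text \<open>For \<open>p = 3 * m + 1\<close>, the \<open>m\<close>-th power of a primitive root is a
  cube root of 1 other than 1 modulo \<open>p\<close>.\<close>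

lemma prime_1_mod_3_cube_root:
  assumes p: "prime p" "[p = 1] (mod 3)"
  obtains t :: int where "int p dvd t\<^sup>2 + t + 1"
proof -
  obtain g where g: "residue_primroot p g" using prime_primitive_root_exists[OF _ p(1)] prime_gt_1_nat[OF p(1)] by blast
  obtain m where m: "p = 3 * m + 1"
  proof
    have "p mod 3 = 1" using p(2) by (simp add: cong_def)
    then show "p = 3 * (p div 3) + 1" by presburger
  qed
  have "m > 0" using prime_gt_1_nat[OF p(1)] m by simp
  have ord: "ord p g = 3 * m" and cop: "coprime p g"
    using g p(1) by (simp_all add: residue_primroot_def totient_prime m)
  have "[int g ^ (3 * m) = 1] (mod int p)"
    using ord_works[of g p] unfolding ord by (metis cong_int_iff of_nat_1 of_nat_power)
  then have "int p dvd (int g ^ m) ^ 3 - 1"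
    by (simp add: cong_iff_dvd_diff mult.commute flip: power_mult)
  also have "(int g ^ m) ^ 3 - 1 = (int g ^ m - 1) * ((int g ^ m)\<^sup>2 + int g ^ m + 1)"
    by (simp add: power3_eq_cube power2_eq_square algebra_simps)
  finally have "int p dvd int g ^ m - 1 \<or> int p dvd (int g ^ m)\<^sup>2 + int g ^ m + 1"
    using p(1) by (subst (asm) prime_dvd_mult_iff) auto
  moreover have "\<not> int p dvd int g ^ m - 1"
  proof
    assume "int p dvd int g ^ m - 1"
    then have "[int (g ^ m) = int 1] (mod int p)" by (simp add: cong_iff_dvd_diff)
    then have "[g ^ m = 1] (mod p)" by (simp only: cong_int_iff)
    then have "3 * m dvd m" unfolding ord_divides ord .
    with \<open>m > 0\<close> show False by (auto dest: dvd_imp_le)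
  qed
  ultimately show ?thesis using that by blast
qed

text \<open>Thue's argument: the pigeonhole principle yields small \<open>x\<close>,
  \<open>y\<close>, not both 0, with \<open>x\<close> congruent to \<open>t * y\<close> modulo
  \<open>p\<close>. Then \<open>p\<close> divides their norm, which is below \<open>3 * p\<close>,
  and the value \<open>2 * p\<close> is excluded.\<close>

lemma prime_1_mod_3_norm:
  assumes p: "prime p" "[p = 1] (mod 3)"
  obtains a b :: int where "int p = a\<^sup>2 + a * b + b\<^sup>2"
proof -
  obtain t where t: "int p dvd t\<^sup>2 + t + 1" using p by (rule prime_1_mod_3_cube_root)
  have p3: "p mod 3 = 1" using p(2) by (simp add: cong_def)
  have p1: "p > 1" using p(1) by (rule prime_gt_1_nat)
  \<comment> \<open>There are \<open>(s + 1)\<^sup>2 > p\<close> pairs with entries up to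
    \<open>s\<close>, while differences of entries have squares below \<open>p\<close>, as
    \<open>p\<close> is not a square.\<close>
  define s where "s = floor_sqrt p"
  have s: "s\<^sup>2 \<le> p" "p < (Suc s)\<^sup>2"
    unfolding s_def by (simp_all add: Suc_floor_sqrt_power2_gt)
  have "s\<^sup>2 \<noteq> p"
  proof
    assume "s\<^sup>2 = p"
    then have "prime (s\<^sup>2)" using p(1) by simp
    then show False by (simp add: prime_power_iff)
  qed
  define F where "F = (\<lambda>(u, v). (int u - t * int v) mod int p)"
  have "F ` ({..s} \<times> {..s}) \<subseteq> {0..<int p}" using p1 by (auto simp: F_def)
  then have "card (F ` ({..s} \<times> {..s})) \<le> card {0..<int p}" by (intro card_mono) auto
  also have "\<dots> < card ({..s} \<times> {..s})" using s(2) by (simp add: power2_eq_square)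
  finally have "\<not> inj_on F ({..s} \<times> {..s})" by (rule pigeonhole)
  then obtain u v u' v' where uv: "u \<le> s" "v \<le> s" "u' \<le> s" "v' \<le> s" "(u, v) \<noteq> (u', v')"
    "F (u, v) = F (u', v')"
    unfolding inj_on_def by auto
  define x where "x = int u - int u'"
  define y where "y = int v - int v'"
  have "int p dvd (int u - t * int v) - (int u' - t * int v')"
    using uv(6) unfolding F_def by (simp add: mod_eq_dvd_iff)
  also have "(int u - t * int v) - (int u' - t * int v') = x - t * y"
    by (simp add: x_def y_def algebra_simps)
  finally obtain k where "x - t * y = int p * k" by blast
  then have x: "x = t * y + int p * k" by simp
  have "x\<^sup>2 + x * y + y\<^sup>2 = (t\<^sup>2 + t + 1) * y\<^sup>2 + int p * (k * (2 * t * y + int p * k + y))"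
    unfolding x by (simp add: power2_eq_square algebra_simps)
  then have "int p dvd x\<^sup>2 + x * y + y\<^sup>2" using t by simp
  then obtain c where c: "x\<^sup>2 + x * y + y\<^sup>2 = int p * c" by blast
  have "\<bar>x\<bar> \<le> int s" "\<bar>y\<bar> \<le> int s" using uv by (auto simp: x_def y_def)
  then have "\<bar>x\<bar>\<^sup>2 \<le> (int s)\<^sup>2" "\<bar>y\<bar>\<^sup>2 \<le> (int s)\<^sup>2" by (intro power_mono; simp)+
  moreover have "(int s)\<^sup>2 < int p" using s(1) \<open>s\<^sup>2 \<noteq> p\<close> by (metis le_neq_implies_less of_nat_less_iff of_nat_power)
  ultimately have "x\<^sup>2 < int p" "y\<^sup>2 < int p" unfolding power2_abs by linarith+
  moreover have "0 \<le> (x - y)\<^sup>2" by simp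
  then have "x * y * 2 \<le> x\<^sup>2 + y\<^sup>2" by (simp add: power2_eq_square algebra_simps)
  ultimately have "x\<^sup>2 + x * y + y\<^sup>2 < int p * 3" by linarith
  then have "c < 3" using p1 unfolding c by simp
  have "x \<noteq> 0 \<or> y \<noteq> 0" using uv by (auto simp: x_def y_def)
  then have "0 < x\<^sup>2 + y\<^sup>2" by (simp add: sum_power2_gt_zero_iff)
  moreover have "0 \<le> (x + y)\<^sup>2" by simp
  ultimately have "0 < x\<^sup>2 + x * y + y\<^sup>2" by (simp add: power2_eq_square algebra_simps)
  then have "c > 0" using p1 unfolding c by (simp add: zero_less_mult_iff)
  \<comment> \<open>The prime 2 is inert, so an even norm is divisible by 4 and \<open>p\<close>
    would be even.\<close>
  have "c \<noteq> 2"
  proof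
    assume "c = 2"
    then have "int 2 dvd x\<^sup>2 + x * y + y\<^sup>2" unfolding c by simp
    then have "int 2 dvd x \<and> int 2 dvd y" by (intro inert_prime_dvd) auto
    then obtain x' y' where "x = 2 * x'" "y = 2 * y'" by (auto simp: dvd_def)
    then have "int p = 2 * (x'\<^sup>2 + x' * y' + y'\<^sup>2)"
      using c \<open>c = 2\<close> by (simp add: power2_eq_square algebra_simps)
    then have "int 2 dvd int p" by simp
    then have "2 dvd p" by (simp only: int_dvd_int_iff)
    then have "p = 2" using primes_dvd_imp_eq[OF two_is_prime_nat p(1)] by simp
    with p3 show False by simp
  qed
  with \<open>c < 3\<close> \<open>c > 0\<close> have "c = 1" by linarith
  with c show ?thesis using that[of x y] by simp
qed

text \<open>Otherwise \<open>z / cnj z\<close> is one of the six units. Each gives a linear relation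
  between the coordinates that makes the norm \<open>p\<close> a square or three times a
  square.\<close>

lemma prime_factor_cnj_pow6_neq:
  assumes p: "prime p" "[p = 1] (mod 3)" and z: "z \<in> factorizations p"
  shows "z ^ 6 \<noteq> cnj z ^ 6"
proof
  assume eq: "z ^ 6 = cnj z ^ 6"
  obtain a b where ab: "z = eis a b" "int p = a\<^sup>2 + a * b + b\<^sup>2" using z by (rule in_factorizationsE)
  have "z \<noteq> 0" using z p(1) by (auto simp: factorizations_def)
  then have "(z / cnj z) ^ 6 = 1" by (simp add: power_divide eq)
  moreover define u where "u = z / cnj z"
  ultimately have "u \<in> {eis 1 0, eis 0 1, eis (-1) 1, eis (-1) 0, eis 0 (-1), eis 1 (-1)}"
    unfolding sixth_root_of_unity_iff by blast
  moreover have "u * eis (a + b) (- b) = eis a b"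
    using \<open>z \<noteq> 0\<close> unfolding cnj_eis[symmetric] ab(1)[symmetric] u_def by simp
  ultimately have "b = 0 \<or> b = - 2 * a \<or> a = b \<or> a = - b \<or> a = 0 \<or> a = - 2 * b"
    by (auto simp: eis_mult eis_inject)
  then have "\<exists>c. int p = c\<^sup>2 \<or> int p = 3 * c\<^sup>2"
    unfolding ab(2) by (auto simp: power2_eq_square)
  then obtain c where c: "int p = c\<^sup>2 \<or> int p = 3 * c\<^sup>2" by blast
  have "\<not> prime (c\<^sup>2)" by (simp add: prime_power_iff)
  then have "int p \<noteq> c\<^sup>2" using p(1) by (metis prime_nat_int_transfer)
  with c have "int p mod 3 = 0" by simp
  moreover have "p mod 3 = 1" using p(2) by (simp add: cong_def)
  then have "int p mod 3 = 1" by presburger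
  ultimately show False by simp
qed

text \<open>With \<open>w\<close> of norm \<open>p\<close>, the prime divides the second coordinate
  of \<open>z * cnj w\<close> or of \<open>z * w\<close>. As the norm of that product is
  \<open>L * p\<close>, it then divides the first coordinate too.\<close>

lemma prime_factor_divides:
  assumes p: "prime p" "[p = 1] (mod 3)" and "p dvd L" and z: "z \<in> factorizations L"
  obtains w y where "w \<in> factorizations p" "y \<in> eisenstein_ints" "z = w * y"
proof -
  note factor = that
  have pp: "prime (int p)" using p by simp
  obtain a b where ab: "int p = a\<^sup>2 + a * b + b\<^sup>2" using p by (rule prime_1_mod_3_norm)
  obtain x y where xy: "z = eis x y" "int L = x\<^sup>2 + x * y + y\<^sup>2" using z by (rule in_factorizationsE)
  have w: "eis a b \<in> factorizations p" using ab by (simp add: eis_in_factorizations_iff)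
  then have w': "cnj (eis a b) \<in> factorizations p"
    unfolding in_factorizations_iff_cmod by (simp add: eisenstein_ints_cnj)
  have "eis a b \<noteq> 0" using w p(1) by (auto simp: factorizations_def)
  \<comment> \<open>\<open>z * cnj w = p * y = w * cnj w * y\<close> gives \<open>z = w * y\<close>\<close>
  have quotient: thesis if w: "w \<in> factorizations p" and AB: "z * cnj w = eis A B" "int p dvd B" for w A B
  proof -
    have norm: "w * cnj w = of_nat p" using w by (simp add: factorizations_def)
    have zn: "z * cnj z = of_nat L" using z by (simp add: factorizations_def)
    have "eis A B * cnj (eis A B) = (z * cnj z) * (w * cnj w)"
      unfolding AB(1)[symmetric] by simp
    also have "\<dots> = of_int (int L * int p)" unfolding norm zn by simp
    finally have "A\<^sup>2 + A * B + B\<^sup>2 = int L * int p" unfolding eis_mult_cnj by (simp only: of_int_eq_iff)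
    then have "A\<^sup>2 = int L * int p - B * (A + B)" by (simp add: power2_eq_square algebra_simps)
    then have "int p dvd A\<^sup>2" using AB(2) by simp
    then have "int p dvd A" using pp prime_dvd_power by blast
    then obtain A' B' where A': "A = int p * A'" "B = int p * B'" using AB(2) by (auto elim!: dvdE)
    have "w \<noteq> 0" using w p(1) by (auto simp: factorizations_def)
    have "z * cnj w = eis (int p) 0 * eis A' B'" unfolding AB(1) A' by (simp add: eis_mult)
    also have "\<dots> = w * eis A' B' * cnj w" unfolding eis_of_int using norm by (simp add: mult_ac)
    finally have "z = w * eis A' B'" using \<open>w \<noteq> 0\<close> by simp
    then show thesis using w by (intro factor[of w "eis A' B'"]) (auto simp: eisenstein_ints_iff)
  qed
  \<comment> \<open>Up to sign, the factors on the right are the second coordinates of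
    \<open>z * cnj (eis a b)\<close> and \<open>z * eis a b\<close>.\<close>
  have "b\<^sup>2 * int L - y\<^sup>2 * int p = (b * x - a * y) * (b * x + a * y + b * y)"
    unfolding xy ab by (simp add: power2_eq_square algebra_simps)
  moreover have "int p dvd b\<^sup>2 * int L - y\<^sup>2 * int p" using \<open>p dvd L\<close> by simp
  ultimately have "int p dvd b * x - a * y \<or> int p dvd b * x + a * y + b * y"
    using prime_dvd_mult_iff[OF pp] by simp
  then show thesis
  proof
    assume "int p dvd b * x - a * y"
    then have "int p dvd - (b * x - a * y)" by (simp only: dvd_minus_iff)
    moreover have "z * cnj (eis a b) = eis (x * (a + b) + y * b) (- (b * x - a * y))"
      unfolding xy cnj_eis eis_mult eis_inject by (simp add: algebra_simps)
    ultimately show thesis using quotient[OF w] by blast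
  next
    assume "int p dvd b * x + a * y + b * y"
    moreover have "z * cnj (cnj (eis a b)) = eis (x * a - y * b) (b * x + a * y + b * y)"
      unfolding xy complex_cnj_cnj eis_mult eis_inject by (simp add: algebra_simps)
    ultimately show thesis using quotient[OF w'] by blast
  qed
qed

text \<open>Nonemptiness matters: 14 has the prime factor 7, but no factorization, because 2 is
  inert and divides it only once.\<close>

lemma card_factorizations_gt_6_iff_prime_factor:
  "card (factorizations L) > 6 \<longleftrightarrow>
    factorizations L \<noteq> {} \<and> (\<exists>p\<in>prime_factors L. [p = 1] (mod 3))"
proof (cases "L = 0")
  case True
  then show ?thesis by (simp add: factorizations_0)
next
  case False
  show ?thesis
  proof
    assume card: "card (factorizations L) > 6"
    then have "factorizations L \<noteq> {}" by auto
    moreover have "\<exists>p\<in>prime_factors L. [p = 1] (mod 3)"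
    proof (rule ccontr)
      assume "\<not> ?thesis"
      then have "\<not> [p = 1] (mod 3)" if "prime p" "p dvd L" for p
        using that False by (auto simp: in_prime_factors_iff)
      then have "z ^ 6 = w ^ 6" if "z \<in> factorizations L" "w \<in> factorizations L" for z w
        using False that by (intro factorizations_pow6_unique[of L]) auto
      with card show False unfolding card_factorizations_gt_6_iff by blast
    qed
    ultimately show "factorizations L \<noteq> {} \<and> (\<exists>p\<in>prime_factors L. [p = 1] (mod 3))" ..
  next
    assume "factorizations L \<noteq> {} \<and> (\<exists>p\<in>prime_factors L. [p = 1] (mod 3))"
    then obtain z p where z: "z \<in> factorizations L" and p: "prime p" "p dvd L" "[p = 1] (mod 3)"
      by (auto simp: in_prime_factors_iff)
    obtain w y where wy: "w \<in> factorizations p" "y \<in> eisenstein_ints" "z = w * y"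
      using prime_factor_divides[OF p(1,3,2) z] .
    \<comment> \<open>Replacing \<open>w\<close> by \<open>cnj w\<close> keeps the norm and changes
      the sixth power.\<close>
    have "cnj w \<in> eisenstein_ints" using wy(1) by (simp add: factorizations_def eisenstein_ints_cnj)
    then have "cnj w * y \<in> factorizations L"
      using z wy unfolding in_factorizations_iff_cmod by (simp add: eisenstein_ints_mult norm_mult)
    moreover have "z \<noteq> 0" using z False by (auto simp: factorizations_def)
    then have "z ^ 6 \<noteq> (cnj w * y) ^ 6"
      using prime_factor_cnj_pow6_neq[OF p(1,3) wy(1)] wy(3) by (simp add: power_mult_distrib)
    ultimately show "card (factorizations L) > 6"
      unfolding card_factorizations_gt_6_iff using z by blast
  qed
qed

subsection \<open>Rational functions with prescribed Fourier coefficient\<close>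

lemma echar_eisenstein: "echar k x \<in> eisenstein_ints"
proof -
  obtain a b where ab: "k = of_int a" "x = of_int b" by (meson obtain_int6)
  have "cis (pi * of_int a * of_int b / 3) ^ 6 = cis (2 * pi * of_int (a * b))"
    unfolding DeMoivre by (rule arg_cong[of _ _ cis]) simp
  also have "\<dots> = 1" by (rule cis_multiple_2pi) simp
  finally show ?thesis
    unfolding ab echar_of_int_cis by (rule sixth_root_of_unity_eisenstein)
qed

lemma common_denominator:
  assumes "finite A" "A \<subseteq> (\<rat> :: complex set)"
  obtains c :: int where "c \<noteq> 0" "\<And>a. a \<in> A \<Longrightarrow> of_int c * a \<in> \<int>"
proof -
  have "\<exists>c::int. c \<noteq> 0 \<and> (\<forall>a\<in>A. of_int c * a \<in> \<int>)"
    using assms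
  proof (induction A rule: finite_induct)
    case empty
    then show ?case by (intro exI[of _ 1]) simp
  next
    case (insert x A)
    then obtain c :: int where c: "c \<noteq> 0" "\<forall>a\<in>A. of_int c * a \<in> \<int>" by auto
    have "x \<in> \<rat>" using insert.prems by simp
    then obtain p q :: int where pq: "q > 0" "x = of_int p / of_int q"
      by (rule Rats_cases')
    have "of_int (c * q) * x = of_int (c * p)" using pq by simp
    then have "of_int (c * q) * x \<in> \<int>" by (metis Ints_of_int)
    moreover have "of_int (c * q) * a \<in> \<int>" if "a \<in> A" for a
    proof -
      have "of_int (c * q) * a = of_int q * (of_int c * a)" by simp
      then show ?thesis using c(2) that by (simp only: Ints_mult Ints_of_int)
    qed
    ultimately show ?case using c(1) pq(1) by (intro exI[of _ "c * q"]) simp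
  qed
  then show ?thesis using that by blast
qed

lemma scale_fourier_eisenstein:
  assumes "\<And>x. of_int c * f x \<in> \<int>"
  shows "of_int c * fourier f (echar k) \<in> eisenstein_ints"
proof -
  have "of_int c * f x * cnj (echar k x) \<in> eisenstein_ints" for x
  proof (rule eisenstein_ints_mult)
    show "of_int c * f x \<in> eisenstein_ints"
      using assms[of x] unfolding eisenstein_ints_iff by (metis Ints_cases eis_of_int)
  qed (simp add: cnj_echar echar_eisenstein)
  then show ?thesis
    unfolding fourier_def sum_distrib_left mult.assoc[symmetric] by (intro eisenstein_ints_sum)
qed

text \<open>A common denominator of all values of \<open>f\<close> and \<open>g\<close> serves as
  the scaling integer, since character values are Eisenstein integers.\<close>

lemma scaled_norm_exists:
  assumes "range f \<subseteq> \<rat>" "range g \<subseteq> \<rat>"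
  shows "\<exists>L. scaled_norm f g L"
proof -
  obtain c :: int where c: "c \<noteq> 0" "\<And>a. a \<in> range f \<union> range g \<Longrightarrow> of_int c * a \<in> \<int>"
    using common_denominator[of "range f \<union> range g"] assms by auto
  have *: "of_int c * fourier f (echar 1) \<in> eisenstein_ints" "of_int c * fourier g (echar 1) \<in> eisenstein_ints"
    using c(2) by (intro scale_fourier_eisenstein; blast)+
  moreover obtain L where "real L = (cmod (of_int c * fourier f (echar 1)))\<^sup>2"
    using *(1) by (rule cmod_eisenstein_square)
  ultimately show ?thesis unfolding scaled_norm_def using c(1) by blast
qed

text \<open>Conjugate coefficients at 1 and -1 make each value one sixth of the trace of an
  Eisenstein integer, hence rational.\<close>

lemma rational_with_fourier_coefficient:
  assumes "z \<in> eisenstein_ints"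
  obtains f :: "6 \<Rightarrow> complex" where "range f \<subseteq> \<rat>"
    "fourier f (echar 1) = z" "\<forall>k\<in>{0, 2, 3, 4}. fourier f (echar k) = 0"
proof
  define f :: "6 \<Rightarrow> complex" where "f x = (z * echar 1 x + cnj z * echar (- 1) x) / 6" for x
  have "f x \<in> \<rat>" for x
  proof -
    have "z * echar 1 x \<in> eisenstein_ints" using assms echar_eisenstein by (rule eisenstein_ints_mult)
    then obtain a b where ab: "z * echar 1 x = eis a b" unfolding eisenstein_ints_iff by blast
    have "f x = (eis a b + cnj (eis a b)) / 6" unfolding f_def ab[symmetric] by (simp add: cnj_echar)
    also have "\<dots> = of_int (2 * a + b) / 6" by (simp add: cnj_eis eis_add eis_of_int)
    also have "\<dots> \<in> \<rat>" by (intro Rats_divide Rats_of_int Rats_number_of)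
    finally show ?thesis .
  qed
  then show "range f \<subseteq> \<rat>" by blast
  have coeff: "fourier f (echar k) = (if k = 1 then z else if k = - 1 then cnj z else 0)" for k
  proof -
    have orth: "(\<Sum>x\<in>UNIV. echar j x * cnj (echar k x)) = (if k = j then 6 else 0)" for j
      using sum_echar[of "j - k"]
      by (simp add: cnj_echar echar_commute[of _ "j - k"] flip: echar_add_left)
    have "fourier f (echar k) = (z * (\<Sum>x\<in>UNIV. echar 1 x * cnj (echar k x))
        + cnj z * (\<Sum>x\<in>UNIV. echar (- 1) x * cnj (echar k x))) / 6"
      unfolding fourier_def f_def sum_distrib_left sum.distrib[symmetric] sum_divide_distrib
      by (intro sum.cong refl) (simp add: field_simps)
    moreover have "(1 :: 6) \<noteq> - 1" unfolding minus_eq_6 by simp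
    ultimately show ?thesis unfolding orth by (cases "k = 1"; cases "k = - 1") auto
  qed
  then show "fourier f (echar 1) = z" by simp
  show "\<forall>k\<in>{0, 2, 3, 4}. fourier f (echar k) = 0"
    unfolding coeff minus_eq_6 by simp
qed

text \<open>The correspondence is split in two: every such pair has some scaled norm
  \<open>L\<close>, and the \<open>L\<close> that occur are exactly those with more than six
  factorizations.\<close>

theorem theoremA:
  shows "(\<forall>f g :: 6 \<Rightarrow> complex. range f \<subseteq> \<rat> \<longrightarrow> range g \<subseteq> \<rat> \<longrightarrow>
            (agree_to_5_not_6 f g \<longleftrightarrow>
               fourier f (echar 0) = fourier g (echar 0)
               \<and> (\<forall>k\<in>{2, 3, 4}. fourier f (echar k) = 0 \<and> fourier g (echar k) = 0)
               \<and> cmod (fourier f (echar 1)) = cmod (fourier g (echar 1))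
               \<and> fourier f (echar 1) ^ 6 \<noteq> fourier g (echar 1) ^ 6))
       \<and> (\<forall>f g :: 6 \<Rightarrow> complex. range f \<subseteq> \<rat> \<longrightarrow> range g \<subseteq> \<rat> \<longrightarrow> agree_to_5_not_6 f g \<longrightarrow>
            (\<exists>L. scaled_norm f g L))
       \<and> (\<forall>L. (\<exists>f g :: 6 \<Rightarrow> complex. range f \<subseteq> \<rat> \<and> range g \<subseteq> \<rat> \<and> agree_to_5_not_6 f g
                  \<and> scaled_norm f g L)
              \<longleftrightarrow> card (factorizations L) > 6)
       \<and> (\<forall>L. card (factorizations L) > 6 \<longleftrightarrow>
              factorizations L \<noteq> {} \<and> (\<exists>p\<in>prime_factors L. [p = 1] (mod 3)))"
proof (intro conjI allI impI)
  fix f g :: "6 \<Rightarrow> complex" assume rat: "range f \<subseteq> \<rat>" "range g \<subseteq> \<rat>"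
  show "agree_to_5_not_6 f g \<longleftrightarrow>
      fourier f (echar 0) = fourier g (echar 0)
      \<and> (\<forall>k\<in>{2, 3, 4}. fourier f (echar k) = 0 \<and> fourier g (echar k) = 0)
      \<and> cmod (fourier f (echar 1)) = cmod (fourier g (echar 1))
      \<and> fourier f (echar 1) ^ 6 \<noteq> fourier g (echar 1) ^ 6"
    using agree_imp_fourier[OF rat] fourier_imp_agree[OF rat] by blast
  show "\<exists>L. scaled_norm f g L" using rat by (rule scaled_norm_exists)
next
  fix L
  show "(\<exists>f g :: 6 \<Rightarrow> complex. range f \<subseteq> \<rat> \<and> range g \<subseteq> \<rat> \<and> agree_to_5_not_6 f g
      \<and> scaled_norm f g L) \<longleftrightarrow> card (factorizations L) > 6"
  proof
    assume "\<exists>f g :: 6 \<Rightarrow> complex. range f \<subseteq> \<rat> \<and> range g \<subseteq> \<rat> \<and> agree_to_5_not_6 f g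
      \<and> scaled_norm f g L"
    then obtain f g :: "6 \<Rightarrow> complex" and c :: int where rat: "range f \<subseteq> \<rat>" "range g \<subseteq> \<rat>"
      and agree: "agree_to_5_not_6 f g" and c: "c \<noteq> 0"
      "of_int c * fourier f (echar 1) \<in> eisenstein_ints"
      "of_int c * fourier g (echar 1) \<in> eisenstein_ints"
      "real L = (cmod (of_int c * fourier f (echar 1)))\<^sup>2"
      unfolding scaled_norm_def by blast
    note fourier = agree_imp_fourier[OF rat agree]
    have "of_int c * fourier f (echar 1) \<in> factorizations L"
      "of_int c * fourier g (echar 1) \<in> factorizations L"
      using c fourier(3) by (simp_all add: in_factorizations_iff_cmod norm_mult)
    moreover have "(of_int c * fourier f (echar 1)) ^ 6 \<noteq> (of_int c * fourier g (echar 1)) ^ 6"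
      using c(1) fourier(4) by (simp add: power_mult_distrib)
    ultimately show "card (factorizations L) > 6"
      unfolding card_factorizations_gt_6_iff by blast
  next
    assume "card (factorizations L) > 6"
    then obtain z w where zw: "z \<in> factorizations L" "w \<in> factorizations L" "z ^ 6 \<noteq> w ^ 6"
      unfolding card_factorizations_gt_6_iff by blast
    \<comment> \<open>Two factorizations with different sixth powers are realized as coefficients at
      1 of functions with zero mean, so the scaling integer is 1.\<close>
    have z: "z \<in> eisenstein_ints" "real L = (cmod z)\<^sup>2" and w: "w \<in> eisenstein_ints" "real L = (cmod w)\<^sup>2"
      using zw by (simp_all add: in_factorizations_iff_cmod)
    obtain f where f: "range f \<subseteq> \<rat>" "fourier f (echar 1) = z"
      "\<forall>k\<in>{0, 2, 3, 4}. fourier f (echar k) = 0"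
      using z(1) by (rule rational_with_fourier_coefficient)
    obtain g where g: "range g \<subseteq> \<rat>" "fourier g (echar 1) = w"
      "\<forall>k\<in>{0, 2, 3, 4}. fourier g (echar k) = 0"
      using w(1) by (rule rational_with_fourier_coefficient)
    have "cmod z = cmod w" using z(2) w(2) by simp
    then have "agree_to_5_not_6 f g"
      using f g zw(3) by (intro fourier_imp_agree) auto
    moreover have "scaled_norm f g L"
      unfolding scaled_norm_def using f(2) g(2) z w by (intro exI[of _ 1]) simp
    ultimately show "\<exists>f g :: 6 \<Rightarrow> complex. range f \<subseteq> \<rat> \<and> range g \<subseteq> \<rat> \<and> agree_to_5_not_6 f g
      \<and> scaled_norm f g L"
      using f(1) g(1) by blast
  qed
next
  fix L
  show "card (factorizations L) > 6 \<longleftrightarrow>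
      factorizations L \<noteq> {} \<and> (\<exists>p\<in>prime_factors L. [p = 1] (mod 3))"
    by (rule card_factorizations_gt_6_iff_prime_factor)
qed

end
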